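(* Let $A:[0,1]^2\to[-1,1]$ be a symmetric measurable function, viewed as the integral operator $(Av)(x)=\int_0^1A(x,y)v(y)\,dy$ on $L^2([0,1])$, with $$A(x,y)=\sum_{\ell=1}^{d}\lambda_\ell f_\ell(x)f_\ell(y),$$ for some finite $d$, nonzero reals $\lambda_\ell$ and orthonormal $f_1,\dots,f_d\in L^2([0,1])$. Let $\alpha_0\in\mathbb{R}$, $\mathbb{A}=\alpha_0\mathbb{I}+A$, $\mathbb{B}=\sum_{k=0}^{b_L}\beta_kA^k$, $Q=\sum_{k=0}^hq_kA^k$, $P_0=\sum_{k=0}^rz_kA^k$ (with $A^0=\mathbb{I}$), and assume $Q$ and $P_0$ are self-adjoint and nonnegative. Write $\mathrm{poly}_B(s)=\sum_k\beta_ks^k$, $\mathrm{poly}_Q(s)=\sum_kq_ks^k$, $\mathrm{poly}_{P_0}(s)=\sum_kz_ks^k$. Consider the problem of minimizing over $\mathbf{u}\in L^2([0,T];L^2([0,1]))$ $$J(\mathbf{u})=\int_0^T\big(\langle\mathbf{x}_t,Q\mathbf{x}_t\rangle+\langle\mathbf{u}_t,\mathbf{u}_t\rangle\big)dt+\langle\mathbf{x}_T,P_0\mathbf{x}_T\rangle$$ subject to $\dot{\mathbf{x}}_t=\mathbb{A}\mathbf{x}_t+\mathbb{B}\mathbf{u}_t$, $t\in[0,T]$, $\mathbf{x}_0\in L^2([0,1])$ given. Then the optimal control law is $$\mathbf{u}_t=-\beta_0\mathbf{L}_{T-t}\breve{\mathbf{x}}_t-\sum_{\ell=1}^d\mathrm{poly}_B(\lambda_\ell)\mathbf{M}^\ell_{T-t}\bar{\mathbf{x}}^\ell_t,$$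 where $\bar{\mathbf{x}}^\ell_t=\langle\mathbf{x}_t,f_\ell\rangle f_\ell$, $\breve{\mathbf{x}}_t=\mathbf{x}_t-\sum_{\ell=1}^d\bar{\mathbf{x}}^\ell_t$, $\mathbf{L}=\{\mathbf{L}_t:t\in[0,T]\}$ is the solution to the Riccati equation $$\dot{\mathbf{L}}_t=2\alpha_0\mathbf{L}_t-\beta_0^2\mathbf{L}_t^2+q_0\mathbb{I},\qquad \mathbf{L}_0=z_0\mathbb{I},$$ and, for $1\le\ell\le d$, $\mathbf{M}^\ell=\{\mathbf{M}^\ell_t:t\in[0,T]\}$ is the solution to the Riccati equation $$\dot{\mathbf{M}}^\ell_t=2(\alpha_0+\lambda_\ell)\mathbf{M}^\ell_t-\mathrm{poly}_B(\lambda_\ell)^2(\mathbf{M}^\ell_t)^2+\mathrm{poly}_Q(\lambda_\ell)\mathbb{I},\qquad \mathbf{M}^\ell_0=\mathrm{poly}_{P_0}(\lambda_\ell)\mathbb{I}.$$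
   Context: $\mathbb{I}$ is the identity on $L^2([0,1])$; $\langle\cdot,\cdot\rangle$ is the $L^2([0,1])$ inner product. For a control $\mathbf{u}\in L^2([0,T];L^2([0,1]))$ the state is the mild solution $\mathbf{x}_t=e^{t\mathbb{A}}\mathbf{x}_0+\int_0^te^{(t-s)\mathbb{A}}\mathbb{B}\mathbf{u}_s\,ds$; the control law is in state feedback form, with $\mathbf{x}$ the resulting closed-loop trajectory. *)

theory Defs
  imports "HOL-Analysis.Analysis"
begin

text \<open>The state space L2([0,1]) is represented by an abstract real Hilbert space type 'h
  together with a unitary identification emb of 'h with L2([0,1]) (square-integrable
  Lebesgue-measurable functions on [0,1] modulo a.e. equality).\<close>

definition L2fun :: "(real \<Rightarrow> real) \<Rightarrow> bool" where
  "L2fun g \<longleftrightarrow> g \<in> borel_measurable (lebesgue_on {0..1})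
      \<and> integrable (lebesgue_on {0..1}) (\<lambda>\<xi>. (g \<xi>)\<^sup>2)"

definition L2_model :: "('h::real_inner \<Rightarrow> (real \<Rightarrow> real)) \<Rightarrow> bool" where
  "L2_model emb \<longleftrightarrow>
     (\<forall>v. L2fun (emb v))
   \<and> (\<forall>v w. inner v w = (LINT \<xi>|lebesgue_on {0..1}. emb v \<xi> * emb w \<xi>))
   \<and> (\<forall>g. L2fun g \<longrightarrow> (\<exists>v. AE \<xi> in lebesgue_on {0..1}. emb v \<xi> = g \<xi>))"

definition is_integral_operator ::
  "('h::real_inner \<Rightarrow> (real \<Rightarrow> real)) \<Rightarrow> (real \<Rightarrow> real \<Rightarrow> real) \<Rightarrow> ('h \<Rightarrow>\<^sub>L 'h) \<Rightarrow> bool" where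
  "is_integral_operator emb K Op \<longleftrightarrow>
     (\<forall>v. AE \<xi> in lebesgue_on {0..1}.
        emb (blinfun_apply Op v) \<xi> = (LINT y|lebesgue_on {0..1}. K \<xi> y * emb v y))"

primrec oppow :: "('a::real_normed_vector \<Rightarrow>\<^sub>L 'a) \<Rightarrow> nat \<Rightarrow> ('a \<Rightarrow>\<^sub>L 'a)" where
  "oppow K 0 = id_blinfun"
| "oppow K (Suc n) = K o\<^sub>L oppow K n"

definition oppoly :: "(nat \<Rightarrow> real) \<Rightarrow> nat \<Rightarrow> ('a::real_normed_vector \<Rightarrow>\<^sub>L 'a) \<Rightarrow> ('a \<Rightarrow>\<^sub>L 'a)" where
  "oppoly c n K = (\<Sum>k\<le>n. c k *\<^sub>R oppow K k)"

definition rpoly :: "(nat \<Rightarrow> real) \<Rightarrow> nat \<Rightarrow> real \<Rightarrow> real" where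
  "rpoly c n s = (\<Sum>k\<le>n. c k * s ^ k)"

definition opexp :: "('a::banach \<Rightarrow>\<^sub>L 'a) \<Rightarrow> ('a \<Rightarrow>\<^sub>L 'a)" where
  "opexp K = (\<Sum>n. (1 / fact n) *\<^sub>R oppow K n)"

definition self_adjoint_op :: "('h::real_inner \<Rightarrow>\<^sub>L 'h) \<Rightarrow> bool" where
  "self_adjoint_op K \<longleftrightarrow> (\<forall>v w. inner (blinfun_apply K v) w = inner v (blinfun_apply K w))"

definition nonneg_op :: "('h::real_inner \<Rightarrow>\<^sub>L 'h) \<Rightarrow> bool" where
  "nonneg_op K \<longleftrightarrow> (\<forall>v. 0 \<le> inner v (blinfun_apply K v))"

definition mild ::
  "('h::{real_inner,banach,second_countable_topology} \<Rightarrow>\<^sub>L 'h) \<Rightarrow> ('h \<Rightarrow>\<^sub>L 'h) \<Rightarrow> 'h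
     \<Rightarrow> (real \<Rightarrow> 'h) \<Rightarrow> real \<Rightarrow> 'h" where
  "mild AA BB x0 u t =
     blinfun_apply (opexp (t *\<^sub>R AA)) x0
     + (LINT s|lebesgue_on {0..t}. blinfun_apply (opexp ((t - s) *\<^sub>R AA)) (blinfun_apply BB (u s)))"

definition admissible :: "real \<Rightarrow> (real \<Rightarrow> 'h::{real_inner,banach,second_countable_topology}) \<Rightarrow> bool" where
  "admissible T u \<longleftrightarrow> u \<in> borel_measurable (lebesgue_on {0..T})
      \<and> integrable (lebesgue_on {0..T}) (\<lambda>t. (norm (u t))\<^sup>2)"

definition cost ::
  "('h::{real_inner,banach,second_countable_topology} \<Rightarrow>\<^sub>L 'h) \<Rightarrow> ('h \<Rightarrow>\<^sub>L 'h) \<Rightarrow> ('h \<Rightarrow>\<^sub>L 'h)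
     \<Rightarrow> ('h \<Rightarrow>\<^sub>L 'h) \<Rightarrow> real \<Rightarrow> 'h \<Rightarrow> (real \<Rightarrow> 'h) \<Rightarrow> real" where
  "cost AA BB Q P0 T x0 u =
     (LINT t|lebesgue_on {0..T}.
        inner (mild AA BB x0 u t) (blinfun_apply Q (mild AA BB x0 u t)) + inner (u t) (u t))
     + inner (mild AA BB x0 u T) (blinfun_apply P0 (mild AA BB x0 u T))"

definition riccati_sol ::
  "real \<Rightarrow> real \<Rightarrow> real \<Rightarrow> real \<Rightarrow> real \<Rightarrow> (real \<Rightarrow> ('h::real_normed_vector \<Rightarrow>\<^sub>L 'h)) \<Rightarrow> bool" where
  "riccati_sol T a b c e L \<longleftrightarrow>
     L 0 = e *\<^sub>R id_blinfun
   \<and> (\<forall>t\<in>{0..T}. (L has_vector_derivative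
        ((2 * a) *\<^sub>R L t - (b\<^sup>2) *\<^sub>R (L t o\<^sub>L L t) + c *\<^sub>R id_blinfun)) (at t within {0..T}))"

end

theory Submission
  imports Defs
begin

text \<open>The kernel operator \<open>A\<close> is diagonal with respect to the projections onto the eigenvectors
  \<open>f\<^sub>l\<close> and onto their orthogonal complement, where it vanishes. Hence the dynamics and the cost decouple
  into \<open>d + 1\<close> Hilbert-space valued control problems with scalar coefficients. Each projection is nonzero
  (for the complement because \<open>L\<^sup>2\<close> is infinite-dimensional), so nonnegativity of \<open>Q\<close> and \<open>P\<^sub>0\<close> makes the
  scalar cost coefficients nonnegative and the scalar Riccati equations solvable. Each scalar problem is
  convex, and the feedback control annihilates its first variation. The closed loop is explicit: along
  \<open>X' = (b\<^sup>2 m - a) X\<close> the mode is \<open>X (T - t) / X T\<close> times its initial value.\<close>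

section \<open>Riccati equations\<close>

text \<open>Controls are only square integrable, so a competing trajectory is known through its
  integral formula and cannot simply be differentiated in order to complete the square. The
  optimality argument therefore differentiates only the Riccati solution and the closed loop, and
  reaches arbitrary directions by exchanging the order of integration. A scalar Riccati equation may
  blow up in finite time; here this is excluded by the signs of its constant term and its initial
  value. The coefficients of the polynomials may have any sign, so the values \<open>poly_Q\<close>
  and \<open>poly_P0\<close> at the eigenvalues have to be shown nonnegative by testing
  \<open>Q\<close> and \<open>P0\<close> on vectors fixed by each projection. The solutions
  \<open>L\<close> and \<open>M\<close> of the theorem are arbitrary operator-valued functions. To
  treat them as scalars, uniqueness is needed among operators.\<close>

lemma scalar_riccati_exists:
  fixes a b c e :: real
  assumes "0 \<le> c" "0 \<le> e"
  obtains X m where "m 0 = e" "\<And>t. 0 \<le> t \<Longrightarrow> 0 < X t"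
    "\<And>t. 0 \<le> t \<Longrightarrow> (X has_real_derivative (b\<^sup>2 * m t - a) * X t) (at t)"
    "\<And>t. 0 \<le> t \<Longrightarrow> (m has_real_derivative 2 * a * m t - b\<^sup>2 * (m t)\<^sup>2 + c) (at t)"
proof -
  \<comment> \<open>\<open>m = Y / X\<close> for the linear Hamiltonian system associated with the Riccati equation.\<close>
  obtain X Y where init: "X 0 = 1" "Y 0 = e" and pos: "\<And>t. 0 \<le> t \<Longrightarrow> 0 < X t"
    and X: "\<And>t. (X has_real_derivative b\<^sup>2 * Y t - a * X t) (at t)"
    and Y: "\<And>t. (Y has_real_derivative a * Y t + c * X t) (at t)"
  \<comment> \<open>The matrix of the system squares to \<open>a^2 + b^2 c\<close> times the
    identity. If this number is zero, the matrix is nilpotent and the solutions are affine in t;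
    otherwise it is positive and they are combinations of cosh and sinh.\<close>
  proof (cases "a = 0 \<and> b\<^sup>2 * c = 0")
    case True
    show ?thesis
    proof (rule that)
      show "0 < 1 + b\<^sup>2 * e * t" if "0 \<le> t" for t
        using that assms by (intro add_pos_nonneg mult_nonneg_nonneg) auto
      show "((\<lambda>t. 1 + b\<^sup>2 * e * t) has_real_derivative
              b\<^sup>2 * (e + c * t) - a * (1 + b\<^sup>2 * e * t)) (at t)" for t
        using True by (auto intro!: derivative_eq_intros simp: algebra_simps)
      show "((\<lambda>t. e + c * t) has_real_derivative a * (e + c * t) + c * (1 + b\<^sup>2 * e * t)) (at t)" for t
        using True by (auto intro!: derivative_eq_intros simp: algebra_simps)
    qed auto
  next
    case False
    define w where "w = sqrt (a\<^sup>2 + b\<^sup>2 * c)"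
    have nn: "0 \<le> b\<^sup>2 * c" using assms by simp
    have w2: "w\<^sup>2 = a\<^sup>2 + b\<^sup>2 * c" using nn by (simp add: w_def)
    have "0 < a\<^sup>2 + b\<^sup>2 * c" using False nn
      by (smt (verit) zero_less_power2 zero_le_power2)
    then have w: "0 < w" by (simp add: w_def)
    have aw: "a \<le> w" unfolding w_def using nn by (intro real_le_rsqrt) auto
    \<comment> \<open>\<open>w * B\<close> and \<open>w * G\<close> are the slopes at time 0 that
      the system prescribes for \<open>X 0 = 1\<close> and \<open>Y 0 = e\<close>.\<close>
    obtain B G where B: "w * B = b\<^sup>2 * e - a" and G: "w * G = a * e + c"
      using w by (metis nonzero_mult_div_cancel_left order_less_irrefl times_divide_eq_right)
    define X where "X t = cosh (w * t) + B * sinh (w * t)" for t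
    define Y where "Y t = e * cosh (w * t) + G * sinh (w * t)" for t
    \<comment> \<open>With these slopes the cosh coefficients on both sides of the system agree; the
      sinh coefficients agree because \<open>w^2 = a^2 + b^2 c\<close>.\<close>
    have "w * (b\<^sup>2 * G - a * B) = b\<^sup>2 * (w * G) - a * (w * B)" by (simp add: algebra_simps)
    also have "\<dots> = w * w" using w2 unfolding B G by (simp add: algebra_simps power2_eq_square)
    finally have BG1: "w = b\<^sup>2 * G - a * B" using w by simp
    have "w * (a * G + c * B) = a * (w * G) + c * (w * B)" by (simp add: algebra_simps)
    also have "\<dots> = w * (e * w)" using w2 unfolding B G by (simp add: algebra_simps power2_eq_square)
    finally have BG2: "e * w = a * G + c * B" using w by simp
    show ?thesis
    proof (rule that)
      show "X 0 = 1" "Y 0 = e" by (auto simp: X_def Y_def)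
      show "0 < X t" if "0 \<le> t" for t
      proof -
        have s: "0 \<le> sinh (w * t)" using w that by simp
        \<comment> \<open>Both sign hypotheses enter: \<open>0 \<le> c\<close> through
          \<open>a \<le> w\<close>, and \<open>0 \<le> e\<close> through
          \<open>0 \<le> b^2 e\<close>. They give \<open>B \<ge> -1\<close>, so X dominates cosh -
          sinh, which is positive.\<close>
        have "w * (-1) \<le> w * B" unfolding B using aw mult_nonneg_nonneg[OF zero_le_power2[of b] assms(2)] by linarith
        then have "-1 \<le> B" using w by (simp only: mult_le_cancel_left_pos)
        then have "- sinh (w * t) \<le> B * sinh (w * t)"
          using mult_right_mono[OF _ s] by (metis mult_minus1)
        then show ?thesis unfolding X_def using sinh_less_cosh_real[of "w * t"] by linarith
      qed
      fix t
      let ?C = "cosh (w * t)" and ?S = "sinh (w * t)"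
      have "(X has_real_derivative ?S * w + B * (?C * w)) (at t)"
        unfolding X_def by (auto intro!: derivative_eq_intros)
      also have "?S * w + B * (?C * w) = ?S * (b\<^sup>2 * G - a * B) + (w * B) * ?C"
        by (subst BG1[symmetric]) (simp add: algebra_simps)
      also have "\<dots> = b\<^sup>2 * Y t - a * X t"
        unfolding B X_def Y_def by (simp add: algebra_simps)
      finally show "(X has_real_derivative b\<^sup>2 * Y t - a * X t) (at t)" .
      have "(Y has_real_derivative e * (?S * w) + G * (?C * w)) (at t)"
        unfolding Y_def by (auto intro!: derivative_eq_intros)
      also have "e * (?S * w) + G * (?C * w) = ?S * (e * w) + (w * G) * ?C"
        by (simp add: algebra_simps)
      also have "\<dots> = a * Y t + c * X t"
        unfolding BG2 G X_def Y_def by (simp add: algebra_simps)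
      finally show "(Y has_real_derivative a * Y t + c * X t) (at t)" .
    qed
  qed
  show ?thesis
  proof (rule that)
    show "Y 0 / X 0 = e" using init by simp
    fix t :: real assume "0 \<le> t"
    then have X0: "X t \<noteq> 0" using pos[of t] by simp
    show "0 < X t" using pos \<open>0 \<le> t\<close> .
    show "(X has_real_derivative (b\<^sup>2 * (Y t / X t) - a) * X t) (at t)"
    proof -
      have "(b\<^sup>2 * (Y t / X t) - a) * X t = b\<^sup>2 * Y t - a * X t"
        using X0 by (simp add: left_diff_distrib)
      then show ?thesis using X[of t] by (simp only:)
    qed
    have "((\<lambda>t. Y t / X t) has_real_derivative
        ((a * Y t + c * X t) * X t - Y t * (b\<^sup>2 * Y t - a * X t)) / (X t * X t)) (at t)"
      using X0 by (intro DERIV_divide X Y)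
    moreover have "((a * Y t + c * X t) * X t - Y t * (b\<^sup>2 * Y t - a * X t)) / (X t * X t)
        = 2 * a * (Y t / X t) - b\<^sup>2 * (Y t / X t)\<^sup>2 + c"
      using X0 by (simp add: field_simps power2_eq_square)
    ultimately show "((\<lambda>t. Y t / X t) has_real_derivative
        2 * a * (Y t / X t) - b\<^sup>2 * (Y t / X t)\<^sup>2 + c) (at t)"
      by simp
  qed
qed

text \<open>Gronwall's argument for the squared norm, which is differentiable even where w vanishes:
  the weight \<open>exp (- (2 * K * s))\<close> makes it nonincreasing. At the end points only
  one-sided derivatives are given, so monotonicity is drawn from interior derivatives and
  continuity.\<close>

lemma vanishing_of_linear_growth:
  fixes w :: "real \<Rightarrow> 'a::real_inner"
  assumes der: "\<And>t. t \<in> {0..T} \<Longrightarrow> (w has_vector_derivative w' t) (at t within {0..T})"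
    and growth: "\<And>t. t \<in> {0..T} \<Longrightarrow> norm (w' t) \<le> K * norm (w t)"
    and init: "w 0 = 0" and t: "t \<in> {0..T}"
  shows "w t = 0"
proof -
  define \<phi> where "\<phi> s = inner (w s) (w s) * exp (- (2 * K * s))" for s
  define \<phi>' where "\<phi>' s = 2 * (inner (w s) (w' s) - K * inner (w s) (w s)) * exp (- (2 * K * s))" for s
  have d: "(\<phi> has_real_derivative \<phi>' s) (at s within {0..T})" if "s \<in> {0..T}" for s
  proof -
    have "((\<lambda>s. inner (w s) (w s)) has_vector_derivative (inner (w s) (w' s) + inner (w' s) (w s)))
            (at s within {0..T})"
      by (rule bounded_bilinear.has_vector_derivative[OF bounded_bilinear_inner der[OF that] der[OF that]])
    then have "((\<lambda>s. inner (w s) (w s)) has_real_derivative 2 * inner (w s) (w' s)) (at s within {0..T})"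
      by (simp add: has_real_derivative_iff_has_vector_derivative inner_commute)
    then show ?thesis unfolding \<phi>_def \<phi>'_def
      by (auto intro!: derivative_eq_intros simp: algebra_simps)
  qed
  have neg: "\<phi>' s \<le> 0" if "s \<in> {0..T}" for s
  proof -
    have "inner (w s) (w' s) \<le> norm (w s) * norm (w' s)" by (rule norm_cauchy_schwarz)
    also have "\<dots> \<le> norm (w s) * (K * norm (w s))" by (intro mult_left_mono growth that) auto
    also have "\<dots> = K * inner (w s) (w s)" by (simp add: dot_square_norm power2_eq_square)
    finally show ?thesis unfolding \<phi>'_def by (simp add: mult_nonpos_nonneg)
  qed
  have "\<phi> t \<le> \<phi> 0"
  proof (rule DERIV_nonpos_imp_decreasing_open[where f = \<phi>])
    show "0 \<le> t" using t by simp
    show "\<exists>y. (\<phi> has_real_derivative y) (at x) \<and> y \<le> 0" if "0 < x" "x < t" for x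
    proof -
      have x: "x \<in> {0..T}" "x \<in> interior {0..T}" using that t by auto
      show ?thesis using d[OF x(1)] neg[OF x(1)] at_within_interior[OF x(2)] by auto
    qed
    show "continuous_on {0..t} \<phi>"
      using t by (intro DERIV_continuous_on[where D = \<phi>'] has_field_derivative_subset[OF d]) auto
  qed
  then have "inner (w t) (w t) \<le> 0" unfolding \<phi>_def init
    by (simp add: mult_le_0_iff)
  then show ?thesis by (metis inner_ge_zero inner_eq_zero_iff order_antisym)
qed

lemma blinfun_eq_scaleR_idI:
  "(\<And>v. blinfun_apply K v = c *\<^sub>R v) \<Longrightarrow> K = c *\<^sub>R id_blinfun"
  by (rule blinfun_eqI) (simp add: blinfun.scaleR_left)

lemma riccati_sol_scalar:
  assumes "m 0 = e" "\<And>t. t \<in> {0..T} \<Longrightarrow> (m has_real_derivative 2 * a * m t - b\<^sup>2 * (m t)\<^sup>2 + c) (at t)"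
  shows "riccati_sol T a b c e (\<lambda>t. m t *\<^sub>R (id_blinfun :: 'a::real_normed_vector \<Rightarrow>\<^sub>L 'a))"
  unfolding riccati_sol_def
proof (intro conjI ballI)
  fix t assume t: "t \<in> {0..T}"
  have "((\<lambda>t. m t *\<^sub>R (id_blinfun :: 'a \<Rightarrow>\<^sub>L 'a)) has_vector_derivative
      (2 * a * m t - b\<^sup>2 * (m t)\<^sup>2 + c) *\<^sub>R id_blinfun) (at t within {0..T})"
    using has_vector_derivative_scaleR[OF DERIV_subset[OF assms(2)[OF t]] has_vector_derivative_const] by simp
  moreover have "(2 * a * m t - b\<^sup>2 * (m t)\<^sup>2 + c) *\<^sub>R (id_blinfun :: 'a \<Rightarrow>\<^sub>L 'a)
    = (2 * a) *\<^sub>R (m t *\<^sub>R id_blinfun) - b\<^sup>2 *\<^sub>R (m t *\<^sub>R id_blinfun o\<^sub>L m t *\<^sub>R id_blinfun) + c *\<^sub>R id_blinfun"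
    by (rule blinfun_eqI) (simp add: blinfun.bilinear_simps algebra_simps power2_eq_square)
  ultimately show "((\<lambda>t. m t *\<^sub>R (id_blinfun :: 'a \<Rightarrow>\<^sub>L 'a)) has_vector_derivative
    (2 * a) *\<^sub>R (m t *\<^sub>R id_blinfun) - b\<^sup>2 *\<^sub>R (m t *\<^sub>R id_blinfun o\<^sub>L m t *\<^sub>R id_blinfun) + c *\<^sub>R id_blinfun)
      (at t within {0..T})" by simp
qed (simp add: assms)

text \<open>The difference of an operator solution and a scalar solution satisfies a linear equation,
  because the scalar solution commutes with everything.\<close>
lemma riccati_sol_unique:
  fixes L :: "real \<Rightarrow> ('h::real_inner \<Rightarrow>\<^sub>L 'h)"
  assumes L: "riccati_sol T a b c e L"
    and m: "m 0 = e" "\<And>t. t \<in> {0..T} \<Longrightarrow> (m has_real_derivative 2 * a * m t - b\<^sup>2 * (m t)\<^sup>2 + c) (at t)"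
    and t: "t \<in> {0..T}"
  shows "L t = m t *\<^sub>R id_blinfun"
proof (rule blinfun_eq_scaleR_idI)
  fix v
  have dL: "(L has_vector_derivative (2 * a) *\<^sub>R L t - (b\<^sup>2) *\<^sub>R (L t o\<^sub>L L t) + c *\<^sub>R id_blinfun)
      (at t within {0..T})" if "t \<in> {0..T}" for t
    using L that by (auto simp: riccati_sol_def)
  have "continuous_on {0..T} L"
    using dL by (intro continuous_on_vector_derivative) auto
  then have "bounded (L ` {0..T})"
    by (intro compact_imp_bounded compact_continuous_image) auto
  then obtain C where C: "\<And>t. t \<in> {0..T} \<Longrightarrow> norm (L t) \<le> C"
    unfolding bounded_iff by blast
  have "continuous_on {0..T} m"
    using m(2) by (intro continuous_at_imp_continuous_on ballI DERIV_isCont) auto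
  then have "bounded (m ` {0..T})"
    by (intro compact_imp_bounded compact_continuous_image) auto
  then obtain C' where C': "\<And>t. t \<in> {0..T} \<Longrightarrow> \<bar>m t\<bar> \<le> C'"
    unfolding bounded_iff real_norm_def by blast
  define w where "w t = blinfun_apply (L t) v - m t *\<^sub>R v" for t
  \<comment> \<open>The constant c cancels, and \<open>L^2 - m^2 = L (L - m) + m (L - m)\<close>
    exhibits the derivative of w as linear in w, with coefficients bounded by compactness.\<close>
  define w' where "w' t = (2 * a - b\<^sup>2 * m t) *\<^sub>R w t - b\<^sup>2 *\<^sub>R blinfun_apply (L t) (w t)" for t
  have "w t = 0"
  proof (rule vanishing_of_linear_growth[where T = T and w' = w' and K = "\<bar>2 * a\<bar> + b\<^sup>2 * C' + b\<^sup>2 * C"])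
    fix t assume t: "t \<in> {0..T}"
    have "((\<lambda>t. blinfun_apply (L t) v) has_vector_derivative
      blinfun_apply ((2 * a) *\<^sub>R L t - (b\<^sup>2) *\<^sub>R (L t o\<^sub>L L t) + c *\<^sub>R id_blinfun) v) (at t within {0..T})"
      by (rule bounded_linear.has_vector_derivative[OF blinfun.bounded_linear_left dL[OF t]])
    moreover have "((\<lambda>t. m t *\<^sub>R v) has_vector_derivative (2 * a * m t - b\<^sup>2 * (m t)\<^sup>2 + c) *\<^sub>R v)
        (at t within {0..T})"
      using has_vector_derivative_scaleR[OF DERIV_subset[OF m(2)[OF t]] has_vector_derivative_const] by simp
    ultimately have "(w has_vector_derivative
      blinfun_apply ((2 * a) *\<^sub>R L t - (b\<^sup>2) *\<^sub>R (L t o\<^sub>L L t) + c *\<^sub>R id_blinfun) v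
       - (2 * a * m t - b\<^sup>2 * (m t)\<^sup>2 + c) *\<^sub>R v) (at t within {0..T})"
      unfolding w_def by (rule has_vector_derivative_diff)
    moreover have "blinfun_apply ((2 * a) *\<^sub>R L t - (b\<^sup>2) *\<^sub>R (L t o\<^sub>L L t) + c *\<^sub>R id_blinfun) v
       - (2 * a * m t - b\<^sup>2 * (m t)\<^sup>2 + c) *\<^sub>R v = w' t"
      unfolding w'_def w_def by (simp add: blinfun.bilinear_simps algebra_simps power2_eq_square)
    ultimately show "(w has_vector_derivative w' t) (at t within {0..T})" by simp
    have "norm (w' t) \<le> \<bar>2 * a - b\<^sup>2 * m t\<bar> * norm (w t) + b\<^sup>2 * norm (blinfun_apply (L t) (w t))"
      unfolding w'_def by (rule order_trans[OF norm_triangle_ineq4]) simp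
    also have "\<dots> \<le> (\<bar>2 * a\<bar> + b\<^sup>2 * C') * norm (w t) + b\<^sup>2 * (C * norm (w t))"
    proof (intro add_mono mult_right_mono mult_left_mono)
      have "\<bar>b\<^sup>2 * m t\<bar> \<le> b\<^sup>2 * C'" using C'[OF t] by (simp add: abs_mult mult_left_mono)
      then show "\<bar>2 * a - b\<^sup>2 * m t\<bar> \<le> \<bar>2 * a\<bar> + b\<^sup>2 * C'" by linarith
      show "norm (blinfun_apply (L t) (w t)) \<le> C * norm (w t)"
        by (rule order_trans[OF norm_blinfun]) (intro mult_right_mono C[OF t], auto)
    qed auto
    also have "\<dots> = (\<bar>2 * a\<bar> + b\<^sup>2 * C' + b\<^sup>2 * C) * norm (w t)" by (simp add: algebra_simps)
    finally show "norm (w' t) \<le> \<dots>" .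
  next
    show "w 0 = 0" using L m(1) by (simp add: w_def riccati_sol_def blinfun.bilinear_simps)
  qed (rule t)
  then show "blinfun_apply (L t) v = m t *\<^sub>R v" by (simp add: w_def)
qed

section \<open>Mild solutions of a single mode\<close>

text \<open>The variation-of-constants formula for y' = a y + b w with scalar a and b. It is used
  both for projected states and, at type \<open>real\<close>, for their inner products with a fixed
  vector.\<close>

definition mode :: "real \<Rightarrow> real \<Rightarrow> 'h \<Rightarrow> (real \<Rightarrow> 'h) \<Rightarrow> real \<Rightarrow> 'h::{banach,second_countable_topology}" where
  "mode a b y0 w t =
     exp (t * a) *\<^sub>R y0 + (LINT s|lebesgue_on {0..t}. (exp ((t - s) * a) * b) *\<^sub>R w s)"

section \<open>Lebesgue integrals over subintervals of the time horizon\<close>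

lemma integral_lebesgue_on_FTC:
  fixes F f :: "real \<Rightarrow> real"
  assumes "u \<le> v" "continuous_on {u..v} f"
    and "\<And>x. x \<in> {u..v} \<Longrightarrow> (F has_real_derivative f x) (at x within {u..v})"
  shows "(LINT x|lebesgue_on {u..v}. f x) = F v - F u"
proof -
  have "(f has_integral F v - F u) {u..v}"
    using assms by (intro fundamental_theorem_of_calculus)
      (auto simp: has_real_derivative_iff_has_vector_derivative)
  then show ?thesis
    using continuous_imp_integrable_real[OF assms(2)]
    by (simp add: lebesgue_integral_eq_integral integral_unique)
qed

lemma lebesgue_on_Icc_eq_restrict:
  fixes t T :: real
  assumes "t \<le> T"
  shows "lebesgue_on {0..t} = restrict_space (lebesgue_on {0..T}) {..t}"
proof -
  have "{0..T} \<inter> {..t} = {0..t}" using assms by auto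
  then show ?thesis by (subst restrict_restrict_space) auto
qed

lemma atMost_sets_lebesgue_on: "{..t} \<inter> space (lebesgue_on {0..T}) \<in> sets (lebesgue_on {0..T})" for t T :: real
  by (auto simp: sets_restrict_space)

text \<open>Moves the dependence on t from the measure into the integrand. All times then share one
  measure space, so that measurability in t and Fubini's theorem can be obtained on its product with
  itself.\<close>

lemma integral_lebesgue_on_Icc_indicator:
  fixes f :: "real \<Rightarrow> 'a::{banach,second_countable_topology}"
  assumes "t \<le> T"
  shows "(LINT s|lebesgue_on {0..t}. f s) = (LINT s|lebesgue_on {0..T}. (if s \<le> t then f s else 0))"
  unfolding lebesgue_on_Icc_eq_restrict[OF assms] integral_restrict_space[OF atMost_sets_lebesgue_on]
  by (intro Bochner_Integration.integral_cong) (auto simp: indicator_def)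

lemma integrable_lebesgue_on_Icc_mono:
  fixes f :: "real \<Rightarrow> 'a::{banach,second_countable_topology}"
  assumes "integrable (lebesgue_on {0..T}) f" "t \<le> T"
  shows "integrable (lebesgue_on {0..t}) f"
  unfolding lebesgue_on_Icc_eq_restrict[OF assms(2)] integrable_restrict_space[OF atMost_sets_lebesgue_on]
proof (rule Bochner_Integration.integrable_bound[OF assms(1)])
  show "(\<lambda>s. indicator {..t} s *\<^sub>R f s) \<in> borel_measurable (lebesgue_on {0..T})"
  proof (intro borel_measurable_scaleR borel_measurable_integrable[OF assms(1)])
    show "indicat_real {..t} \<in> borel_measurable (lebesgue_on {0..T})"
      by (intro measurable_restrict_space1 borel_measurable_indicator) auto
  qed
qed (auto simp: indicator_def)

lemma admissible_integrable:
  assumes "admissible T u"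
  shows "integrable (lebesgue_on {0..T}) u"
proof (rule Bochner_Integration.integrable_bound)
  show "integrable (lebesgue_on {0..T}) (\<lambda>t. 1 + (norm (u t))\<^sup>2)"
    using assms by (auto simp: admissible_def)
  show "u \<in> borel_measurable (lebesgue_on {0..T})" using assms by (simp add: admissible_def)
  have "norm (u t) \<le> 1 + (norm (u t))\<^sup>2" for t
  proof -
    have "2 * norm (u t) \<le> (norm (u t))\<^sup>2 + 1"
      using zero_le_power2[of "norm (u t) - 1"] by (simp add: power2_diff)
    then show ?thesis using zero_le_power2[of "norm (u t)"] norm_ge_zero[of "u t"] by linarith
  qed
  then show "AE x in lebesgue_on {0..T}. norm (u x) \<le> norm (1 + (norm (u x))\<^sup>2)"
    by (intro AE_I2) (metis abs_of_nonneg add_nonneg_nonneg real_norm_def zero_le_one zero_le_power2)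
qed

lemma continuous_imp_bounded_measurable:
  fixes u :: "real \<Rightarrow> 'a::real_normed_vector"
  assumes "continuous_on {0..T} u"
  shows "u \<in> borel_measurable (lebesgue_on {0..T})"
    and "\<exists>C\<ge>0. \<forall>t\<in>{0..T}. norm (u t) \<le> C"
proof -
  show "u \<in> borel_measurable (lebesgue_on {0..T})"
    using assms by (intro continuous_imp_measurable_on_sets_lebesgue) auto
  have "bounded (u ` {0..T})"
    using assms by (intro compact_imp_bounded compact_continuous_image) auto
  then obtain C where "\<forall>t\<in>{0..T}. norm (u t) \<le> C" unfolding bounded_iff by blast
  then show "\<exists>C\<ge>0. \<forall>t\<in>{0..T}. norm (u t) \<le> C"
    by (intro exI[of _ "max C 0"]) (auto simp: le_max_iff_disj)
qed

lemma integrable_lebesgue_on_bounded: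
  fixes u :: "real \<Rightarrow> 'a::{banach,second_countable_topology}"
  assumes "u \<in> borel_measurable (lebesgue_on {0..T})" "\<And>t. t \<in> {0..T} \<Longrightarrow> norm (u t) \<le> C"
  shows "integrable (lebesgue_on {0..T}) u"
  using assms by (intro finite_measure.integrable_const_bound[OF finite_measure_lebesgue_on, where B = C])
    (auto intro!: AE_I2)

lemma admissible_continuous:
  fixes u :: "real \<Rightarrow> 'h::{real_inner,banach,second_countable_topology}"
  assumes u: "continuous_on {0..T} u"
  shows "admissible T u"
  unfolding admissible_def
proof
  show "u \<in> borel_measurable (lebesgue_on {0..T})"
    by (rule continuous_imp_bounded_measurable[OF u])
  show "integrable (lebesgue_on {0..T}) (\<lambda>t. (norm (u t))\<^sup>2)"
    by (intro continuous_imp_integrable_real continuous_intros u)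
qed

lemma exp_mult_bound:
  fixes a r T :: real
  assumes "\<bar>r\<bar> \<le> T" shows "exp (r * a) \<le> exp (T * \<bar>a\<bar>)"
proof -
  have "r * a \<le> \<bar>r\<bar> * \<bar>a\<bar>" by (metis abs_ge_self abs_mult)
  also have "\<dots> \<le> T * \<bar>a\<bar>" using assms by (intro mult_right_mono) auto
  finally show ?thesis by simp
qed

lemma id_borel_measurable_lebesgue_on: "(\<lambda>x. x) \<in> borel_measurable (lebesgue_on S)" for S :: "real set"
  by (intro measurable_restrict_space1 measurable_completion) auto

lemma kernel_integrable:
  fixes w :: "real \<Rightarrow> 'a::{banach,second_countable_topology}"
  assumes w: "integrable (lebesgue_on {0..T}) w" and t: "0 \<le> t" "t \<le> T"
  shows "integrable (lebesgue_on {0..t}) (\<lambda>s. (exp ((t - s) * a) * b) *\<^sub>R w s)"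
proof (rule Bochner_Integration.integrable_bound)
  have wt: "integrable (lebesgue_on {0..t}) w"
    by (rule integrable_lebesgue_on_Icc_mono[OF w t(2)])
  note [measurable] = borel_measurable_integrable[OF wt] id_borel_measurable_lebesgue_on
  show "integrable (lebesgue_on {0..t}) (\<lambda>s. (exp (T * \<bar>a\<bar>) * \<bar>b\<bar>) * norm (w s))"
    using wt by auto
  show "(\<lambda>s. (exp ((t - s) * a) * b) *\<^sub>R w s) \<in> borel_measurable (lebesgue_on {0..t})"
    by measurable
  show "AE s in lebesgue_on {0..t}. norm ((exp ((t - s) * a) * b) *\<^sub>R w s)
          \<le> norm ((exp (T * \<bar>a\<bar>) * \<bar>b\<bar>) * norm (w s))"
    using t by (intro AE_I2) (auto simp: abs_mult intro!: mult_right_mono exp_mult_bound)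
qed

text \<open>A trajectory enters the cost through its squared norm, for which measurability and a
  uniform bound suffice. The former comes from a parametrised integral over the square, the latter
  from bounding every exponential by \<open>exp (T * \<bar>a\<bar>)\<close>.\<close>

lemma mode_measurable_bounded:
  fixes w :: "real \<Rightarrow> 'h::{real_inner,banach,second_countable_topology}"
  assumes w: "integrable (lebesgue_on {0..T}) w"
  shows "mode a b y0 w \<in> borel_measurable (lebesgue_on {0..T})"
    and "\<exists>C\<ge>0. \<forall>t\<in>{0..T}. norm (mode a b y0 w t) \<le> C"
proof -
  let ?M = "lebesgue_on {0..T}"
  interpret finite_measure ?M by (rule finite_measure_lebesgue_on) auto
  note [measurable] = borel_measurable_integrable[OF w] id_borel_measurable_lebesgue_on
  have [measurable]: "fst \<in> borel_measurable (?M \<Otimes>\<^sub>M ?M)" "snd \<in> borel_measurable (?M \<Otimes>\<^sub>M ?M)"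
    using measurable_compose[OF measurable_fst id_borel_measurable_lebesgue_on]
      measurable_compose[OF measurable_snd id_borel_measurable_lebesgue_on] by auto
  have "(\<lambda>t. LINT s|?M. (if s \<le> t then (exp ((t - s) * a) * b) *\<^sub>R w s else 0)) \<in> borel_measurable ?M"
    by (intro borel_measurable_lebesgue_integral) (simp add: case_prod_beta)
  then have "(\<lambda>t. exp (t * a) *\<^sub>R y0 + (LINT s|?M. (if s \<le> t then (exp ((t - s) * a) * b) *\<^sub>R w s else 0)))
     \<in> borel_measurable ?M"
    by simp
  then show "mode a b y0 w \<in> borel_measurable ?M"
    by (rule measurable_cong[THEN iffD1, rotated])
      (simp add: mode_def integral_lebesgue_on_Icc_indicator[symmetric])
  define C where "C = exp (T * \<bar>a\<bar>) * norm y0 + (LINT s|?M. (exp (T * \<bar>a\<bar>) * \<bar>b\<bar>) * norm (w s))"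
  show "\<exists>C\<ge>0. \<forall>t\<in>{0..T}. norm (mode a b y0 w t) \<le> C"
  proof (intro exI[of _ C] conjI ballI)
    show "0 \<le> C" unfolding C_def by (intro add_nonneg_nonneg integral_nonneg_AE AE_I2) auto
    fix t assume t: "t \<in> {0..T}"
    have "norm (mode a b y0 w t) \<le> exp (t * a) * norm y0
        + norm (LINT s|lebesgue_on {0..t}. (exp ((t - s) * a) * b) *\<^sub>R w s)"
      unfolding mode_def by (rule order_trans[OF norm_triangle_ineq]) simp
    also have "\<dots> \<le> C" unfolding C_def
    proof (intro add_mono mult_right_mono exp_mult_bound)
      have "norm (LINT s|lebesgue_on {0..t}. (exp ((t - s) * a) * b) *\<^sub>R w s)
          = norm (LINT s|?M. (if s \<le> t then (exp ((t - s) * a) * b) *\<^sub>R w s else 0))"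
        using t by (subst integral_lebesgue_on_Icc_indicator[where T = T]) auto
      also have "\<dots> \<le> (LINT s|?M. norm (if s \<le> t then (exp ((t - s) * a) * b) *\<^sub>R w s else 0))"
        by (rule integral_norm_bound)
      also have "\<dots> \<le> (LINT s|?M. (exp (T * \<bar>a\<bar>) * \<bar>b\<bar>) * norm (w s))"
        using t w by (intro Bochner_Integration.integral_mono')
          (auto simp: abs_mult intro!: mult_right_mono exp_mult_bound)
      finally show "norm (LINT s|lebesgue_on {0..t}. (exp ((t - s) * a) * b) *\<^sub>R w s) \<le> \<dots>" .
    qed (use t in auto)
    finally show "norm (mode a b y0 w t) \<le> C" .
  qed
qed

lemma mode_diff:
  fixes w u :: "real \<Rightarrow> 'h::{banach,second_countable_topology}"
  assumes "integrable (lebesgue_on {0..T}) w" "integrable (lebesgue_on {0..T}) u" "t \<in> {0..T}"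
  shows "mode a b y0 w t - mode a b y0 u t = mode a b 0 (\<lambda>s. w s - u s) t"
  using assms kernel_integrable[OF assms(1), of t a b] kernel_integrable[OF assms(2), of t a b]
  by (simp add: mode_def scaleR_right_diff_distrib)

text \<open>Computes the adjoint of the map from controls to states: integrating over the triangle s
  \<le> t in the other order turns the response to w into w itself, tested against a backward
  integral of y. The kernel is absolutely integrable since it is dominated by a constant times
  \<open>norm (w s)\<close>.\<close>

lemma mode_fubini:
  fixes y w :: "real \<Rightarrow> 'h::{real_inner,banach,second_countable_topology}"
  assumes y: "continuous_on {0..T} y" and w: "integrable (lebesgue_on {0..T}) w"
  shows "integrable (lebesgue_on {0..T}) (\<lambda>t. inner (y t) (mode a b 0 w t))"
    and "integrable (lebesgue_on {0..T})
          (\<lambda>s. LINT t|lebesgue_on {s..T}. exp ((t - s) * a) * b * inner (y t) (w s))"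
    and "(LINT t|lebesgue_on {0..T}. inner (y t) (mode a b 0 w t)) =
         (LINT s|lebesgue_on {0..T}. LINT t|lebesgue_on {s..T}. exp ((t - s) * a) * b * inner (y t) (w s))"
proof -
  let ?M = "lebesgue_on {0..T}"
  interpret finite_measure ?M by (rule finite_measure_lebesgue_on) auto
  interpret P: pair_sigma_finite ?M ?M ..
  obtain C where C: "0 \<le> C" "\<And>t. t \<in> {0..T} \<Longrightarrow> norm (y t) \<le> C"
    using continuous_imp_bounded_measurable(2)[OF y] by blast
  note [measurable] = borel_measurable_integrable[OF w] continuous_imp_bounded_measurable(1)[OF y]
    id_borel_measurable_lebesgue_on
  have [measurable]: "fst \<in> borel_measurable (?M \<Otimes>\<^sub>M ?M)" "snd \<in> borel_measurable (?M \<Otimes>\<^sub>M ?M)"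
    using measurable_compose[OF measurable_fst id_borel_measurable_lebesgue_on]
      measurable_compose[OF measurable_snd id_borel_measurable_lebesgue_on] by auto
  define K where "K t s = (if s \<le> t then exp ((t - s) * a) * b * inner (y t) (w s) else 0)" for t s
  have K[measurable]: "case_prod K \<in> borel_measurable (?M \<Otimes>\<^sub>M ?M)"
    unfolding K_def by (simp add: case_prod_beta)
  have Kb: "\<bar>K t s\<bar> \<le> (exp (T * \<bar>a\<bar>) * \<bar>b\<bar> * C) * norm (w s)" if "t \<in> {0..T}" "s \<in> {0..T}" for t s
  proof -
    have "\<bar>inner (y t) (w s)\<bar> \<le> C * norm (w s)"
      by (rule order_trans[OF Cauchy_Schwarz_ineq2]) (intro mult_right_mono C that, auto)
    then have "exp ((t - s) * a) * \<bar>b\<bar> * \<bar>inner (y t) (w s)\<bar>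
        \<le> exp (T * \<bar>a\<bar>) * \<bar>b\<bar> * (C * norm (w s))"
      using that by (intro mult_mono exp_mult_bound) auto
    then show ?thesis using C by (auto simp: K_def abs_mult mult.assoc)
  qed
  have int2: "integrable ?M (\<lambda>s. K t s)" if "t \<in> {0..T}" for t
  proof (rule Bochner_Integration.integrable_bound)
    show "integrable ?M (\<lambda>s. (exp (T * \<bar>a\<bar>) * \<bar>b\<bar> * C) * norm (w s))" using w by auto
    show "(\<lambda>s. K t s) \<in> borel_measurable ?M"
      using measurable_Pair2[OF K] that by simp
    show "AE s in ?M. norm (K t s) \<le> norm (exp (T * \<bar>a\<bar>) * \<bar>b\<bar> * C * norm (w s))"
      using Kb[OF that] C by (intro AE_I2) (auto simp: abs_mult)
  qed
  have int: "integrable (?M \<Otimes>\<^sub>M ?M) (case_prod K)"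
  proof (rule P.Fubini_integrable[OF K])
    show "AE x in ?M. integrable ?M (\<lambda>y. case (x, y) of (x, xa) \<Rightarrow> K x xa)"
      using int2 by (intro AE_I2) auto
    show "integrable ?M (\<lambda>x. LINT y|?M. norm (case (x, y) of (x, xa) \<Rightarrow> K x xa))"
    proof (rule integrable_lebesgue_on_bounded)
      show "(\<lambda>x. LINT y|?M. norm (case (x, y) of (x, xa) \<Rightarrow> K x xa)) \<in> borel_measurable ?M"
        by (intro borel_measurable_lebesgue_integral) (use K in simp)
      fix t assume t: "t \<in> {0..T}"
      have "(LINT s|?M. \<bar>K t s\<bar>) \<le> (LINT s|?M. (exp (T * \<bar>a\<bar>) * \<bar>b\<bar> * C) * norm (w s))"
        using Kb[OF t] w C(1) by (intro Bochner_Integration.integral_mono') auto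
      then show "norm (LINT y|?M. norm (case (t, y) of (x, xa) \<Rightarrow> K x xa))
          \<le> (LINT s|?M. (exp (T * \<bar>a\<bar>) * \<bar>b\<bar> * C) * norm (w s))"
        by simp
    qed
  qed
  have inner1: "(LINT s|?M. K t s) = inner (y t) (mode a b 0 w t)" if "t \<in> {0..T}" for t
  proof -
    have "(LINT s|?M. K t s) = (LINT s|lebesgue_on {0..t}. exp ((t - s) * a) * b * inner (y t) (w s))"
      using that unfolding K_def by (subst integral_lebesgue_on_Icc_indicator) auto
    also have "\<dots> = (LINT s|lebesgue_on {0..t}. inner (y t) ((exp ((t - s) * a) * b) *\<^sub>R w s))"
      by simp
    also have "\<dots> = inner (y t) (LINT s|lebesgue_on {0..t}. (exp ((t - s) * a) * b) *\<^sub>R w s)"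
      using that w by (intro integral_inner_right kernel_integrable) auto
    finally show ?thesis by (simp add: mode_def)
  qed
  have inner2: "(LINT t|?M. K t s) = (LINT t|lebesgue_on {s..T}. exp ((t - s) * a) * b * inner (y t) (w s))"
    if "s \<in> {0..T}" for s
  proof -
    have "{0..T} \<inter> {s..} = {s..T}" using that by auto
    then have eq: "lebesgue_on {s..T} = restrict_space ?M {s..}"
      by (subst restrict_restrict_space) auto
    have "{s..} \<inter> space ?M \<in> sets ?M" by (auto simp: sets_restrict_space)
    then show ?thesis unfolding eq
      by (subst integral_restrict_space) (auto simp: K_def indicator_def intro!: Bochner_Integration.integral_cong)
  qed
  have "integrable ?M (\<lambda>t. inner (y t) (mode a b 0 w t)) \<longleftrightarrow> integrable ?M (\<lambda>t. LINT s|?M. K t s)"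
    by (intro Bochner_Integration.integrable_cong refl) (simp add: inner1)
  then show "integrable ?M (\<lambda>t. inner (y t) (mode a b 0 w t))"
    using P.integrable_fst[OF int] by simp
  have "integrable ?M (\<lambda>s. LINT t|lebesgue_on {s..T}. exp ((t - s) * a) * b * inner (y t) (w s))
      \<longleftrightarrow> integrable ?M (\<lambda>s. LINT t|?M. K t s)"
    by (intro Bochner_Integration.integrable_cong refl) (subst inner2, auto)
  then show "integrable ?M (\<lambda>s. LINT t|lebesgue_on {s..T}. exp ((t - s) * a) * b * inner (y t) (w s))"
    using P.integrable_snd[OF int] by simp
  have "(LINT t|?M. inner (y t) (mode a b 0 w t)) = (LINT t|?M. LINT s|?M. K t s)"
    using inner1 by (intro Bochner_Integration.integral_cong) auto
  also have "\<dots> = (LINT s|?M. LINT t|?M. K t s)" by (rule P.Fubini_integral[OF int, symmetric])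
  also have "\<dots> = (LINT s|?M. LINT t|lebesgue_on {s..T}. exp ((t - s) * a) * b * inner (y t) (w s))"
    by (intro Bochner_Integration.integral_cong refl inner2) simp
  finally show "(LINT t|?M. inner (y t) (mode a b 0 w t)) = \<dots>" .
qed

text \<open>Reduces a vector-valued mode to a real one, to which the real calculus of
  \<open>costate_formula\<close> applies.\<close>

lemma mode_inner:
  fixes w :: "real \<Rightarrow> 'h::{real_inner,banach,second_countable_topology}"
  assumes "integrable (lebesgue_on {0..T}) w" "t \<in> {0..T}"
  shows "inner v (mode a b y0 w t) = mode a b (inner v y0) (\<lambda>s. inner v (w s)) t"
  using kernel_integrable[OF assms(1), of t a b] assms(2)
  by (simp add: mode_def inner_add_right flip: integral_inner_right)

text \<open>The costate \<open>p g\<close> solves the adjoint equation; the identity is its variation-of-constants formula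
  backwards from the terminal time.\<close>
lemma costate_formula:
  fixes g p :: "real \<Rightarrow> real"
  assumes g: "continuous_on {0..T} g" "\<And>t. t \<in> {0..T} \<Longrightarrow> g t = mode a b g0 (\<lambda>s. - (b * p s) * g s) t"
    and p: "p T = z" "\<And>t. t \<in> {0..T} \<Longrightarrow>
        (p has_real_derivative - (2 * a * p t) + b\<^sup>2 * (p t)\<^sup>2 - q) (at t within {0..T})"
    and s: "s \<in> {0..T}"
  shows "p s * g s = exp ((T - s) * a) * z * g T + q * (LINT t|lebesgue_on {s..T}. exp ((t - s) * a) * g t)"
proof -
  have pc: "continuous_on {0..T} p" by (rule DERIV_continuous_on[OF p(2)])
  \<comment> \<open>Pulling \<open>exp (t * a)\<close> out of the convolution leaves an integrand
    free of t. The integral then depends on t only through its upper limit, and continuity of the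
    feedback makes it differentiable.\<close>
  define k where "k r = exp (- r * a) * b * (- (b * p r) * g r)" for r
  have kc: "continuous_on {0..T} k" unfolding k_def by (intro continuous_intros pc g)
  have geq: "g t = exp (t * a) * (g0 + integral {0..t} k)" if t: "t \<in> {0..T}" for t
  proof -
    have "integrable (lebesgue_on {0..t}) k"
      using kc t by (intro continuous_imp_integrable_real) (auto elim: continuous_on_subset)
    then have k: "(LINT s|lebesgue_on {0..t}. k s) = integral {0..t} k"
      by (intro lebesgue_integral_eq_integral) auto
    have "(exp ((t - s) * a) * b) *\<^sub>R (- (b * p s) * g s) = exp (t * a) * k s" for s
      by (simp add: k_def exp_diff exp_minus left_diff_distrib divide_inverse)
    then have "g t = exp (t * a) *\<^sub>R g0 + (LINT s|lebesgue_on {0..t}. exp (t * a) * k s)"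
      using g(2)[OF t] by (simp add: mode_def)
    then show ?thesis using k by (simp add: distrib_left)
  qed
  have gd: "(g has_real_derivative a * g t - b\<^sup>2 * p t * g t) (at t within {0..T})" if t: "t \<in> {0..T}" for t
  proof -
    have "((\<lambda>t. exp (t * a) * (g0 + integral {0..t} k)) has_real_derivative
      exp (t * a) * a * (g0 + integral {0..t} k) + exp (t * a) * k t) (at t within {0..T})"
      using integral_has_real_derivative[OF kc t]
      by (auto intro!: derivative_eq_intros simp: algebra_simps)
    also have "exp (t * a) * a * (g0 + integral {0..t} k) + exp (t * a) * k t = a * g t - b\<^sup>2 * p t * g t"
    proof -
      have "exp (t * a) * k t = - (b\<^sup>2 * p t * g t)"
        by (simp add: k_def exp_minus power2_eq_square)
      then show ?thesis using geq[OF t] by (simp add: mult.assoc mult.left_commute)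
    qed
    finally show ?thesis
      by (rule has_field_derivative_transform_within[where d = 1]) (use t geq in auto)
  qed
  \<comment> \<open>In the derivative of \<open>p * g\<close> the two b^2 terms cancel, leaving
    \<open>- a * p * g - q * g\<close>; the exponential weight removes the first of these.\<close>
  define F where "F t = exp ((t - s) * a) * (p t * g t)" for t
  have Fd: "(F has_real_derivative - q * (exp ((t - s) * a) * g t)) (at t within {s..T})" if t: "t \<in> {s..T}" for t
  proof -
    have t': "t \<in> {0..T}" using t s by auto
    note d = DERIV_subset[OF p(2)[OF t'], of "{s..T}"] DERIV_subset[OF gd[OF t'], of "{s..T}"]
    show ?thesis unfolding F_def
      using s by (auto intro!: derivative_eq_intros d simp: algebra_simps power2_eq_square)
  qed
  have "(LINT t|lebesgue_on {s..T}. - q * (exp ((t - s) * a) * g t)) = F T - F s"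
    using s by (intro integral_lebesgue_on_FTC Fd continuous_intros continuous_on_subset[OF g(1)]) auto
  then show ?thesis using p(1) by (simp add: F_def algebra_simps)
qed


lemma mode_cost_integrable:
  fixes w :: "real \<Rightarrow> 'h::{real_inner,banach,second_countable_topology}"
  assumes w: "admissible T w"
  shows "integrable (lebesgue_on {0..T}) (\<lambda>t. q * (norm (mode a b y0 w t))\<^sup>2 + (norm (w t))\<^sup>2)"
proof -
  note [measurable] = mode_measurable_bounded(1)[OF admissible_integrable[OF w], of a b y0]
  obtain C where C: "\<And>t. t \<in> {0..T} \<Longrightarrow> norm (mode a b y0 w t) \<le> C"
    using mode_measurable_bounded(2)[OF admissible_integrable[OF w], of a b y0] by blast
  have "integrable (lebesgue_on {0..T}) (\<lambda>t. (norm (mode a b y0 w t))\<^sup>2)"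
  proof (rule integrable_lebesgue_on_bounded)
    show "norm ((norm (mode a b y0 w t))\<^sup>2) \<le> C\<^sup>2" if "t \<in> {0..T}" for t
      using C[OF that] by (simp add: power_mono)
  qed measurable
  then show ?thesis using w by (auto simp: admissible_def)
qed

text \<open>The cost is a convex quadratic functional, so it suffices that its first variation at the feedback
  control vanishes in every direction. By Fubini that variation is the integral of the direction against
  the costate formula.\<close>
lemma lq_mode_optimal:
  fixes y w :: "real \<Rightarrow> 'h::{real_inner,banach,second_countable_topology}"
  assumes y: "continuous_on {0..T} y"
      "\<And>t. t \<in> {0..T} \<Longrightarrow> y t = mode a b y0 (\<lambda>s. (- (b * p s)) *\<^sub>R y s) t"
    and p: "p T = z" "\<And>t. t \<in> {0..T} \<Longrightarrow>
        (p has_real_derivative - (2 * a * p t) + b\<^sup>2 * (p t)\<^sup>2 - q) (at t within {0..T})"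
    and nonneg: "0 \<le> q" "0 \<le> z" "0 \<le> T"
    and w: "admissible T w"
  defines "u \<equiv> \<lambda>s. (- (b * p s)) *\<^sub>R y s"
  shows "(LINT t|lebesgue_on {0..T}. q * (norm (mode a b y0 u t))\<^sup>2 + (norm (u t))\<^sup>2)
      + z * (norm (mode a b y0 u T))\<^sup>2
    \<le> (LINT t|lebesgue_on {0..T}. q * (norm (mode a b y0 w t))\<^sup>2 + (norm (w t))\<^sup>2)
      + z * (norm (mode a b y0 w T))\<^sup>2"
proof -
  let ?M = "lebesgue_on {0..T}"
  have pc: "continuous_on {0..T} p" by (rule DERIV_continuous_on[OF p(2)])
  have uc: "continuous_on {0..T} u" unfolding u_def by (intro continuous_intros pc y)
  have ua: "admissible T u" by (rule admissible_continuous[OF uc])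
  note ui = admissible_integrable[OF ua] and wi = admissible_integrable[OF w]
  define \<delta> where "\<delta> s = w s - u s" for s
  have \<delta>: "integrable ?M \<delta>" unfolding \<delta>_def using ui wi by simp
  define \<eta> where "\<eta> = mode a b 0 \<delta>"
  have y_eq: "y t = mode a b y0 u t" if "t \<in> {0..T}" for t using y(2)[OF that] by (simp add: u_def)
  have w_eq: "mode a b y0 w t = y t + \<eta> t" if "t \<in> {0..T}" for t
    using mode_diff[OF wi ui that, of a b y0] y_eq[OF that] by (simp add: \<eta>_def \<delta>_def[abs_def] algebra_simps)
  have T: "T \<in> {0..T}" using nonneg by simp
  \<comment> \<open>Stated for every fixed vector v, because it is later applied at each time s to
    the varying vector \<open>\<delta> s\<close>.\<close>
  have costate: "p s * inner v (y s) = exp ((T - s) * a) * z * inner v (y T)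
      + q * (LINT t|lebesgue_on {s..T}. exp ((t - s) * a) * inner v (y t))" if "s \<in> {0..T}" for s v
  proof (rule costate_formula[OF _ _ p that])
    show "continuous_on {0..T} (\<lambda>t. inner v (y t))" by (intro continuous_intros y)
    show "inner v (y t) = mode a b (inner v y0) (\<lambda>s. - (b * p s) * inner v (y s)) t" if "t \<in> {0..T}" for t
      using mode_inner[OF ui that, of v a b y0] y_eq[OF that] by (simp add: u_def)
  qed
  note fub = mode_fubini[OF y(1) \<delta>, of a b, folded \<eta>_def]
  have \<eta>T: "inner (y T) (\<eta> T) = (LINT s|?M. exp ((T - s) * a) * b * inner (y T) (\<delta> s))"
    unfolding \<eta>_def by (subst mode_inner[OF \<delta> T]) (simp add: mode_def)
  have u\<delta>: "integrable ?M (\<lambda>s. inner (u s) (\<delta> s))"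
  proof (rule Bochner_Integration.integrable_bound)
    show "integrable ?M (\<lambda>s. 2 * (norm (u s))\<^sup>2 + (norm (w s))\<^sup>2)"
      using ua w by (auto simp: admissible_def)
    note [measurable] = borel_measurable_integrable[OF ui] borel_measurable_integrable[OF \<delta>]
    show "(\<lambda>s. inner (u s) (\<delta> s)) \<in> borel_measurable ?M" by measurable
    have "\<bar>inner (u s) (\<delta> s)\<bar> \<le> 2 * (norm (u s))\<^sup>2 + (norm (w s))\<^sup>2" for s
    proof -
      have "\<bar>inner (u s) (\<delta> s)\<bar> \<le> norm (u s) * norm (w s) + (norm (u s))\<^sup>2"
        unfolding \<delta>_def inner_diff_right using Cauchy_Schwarz_ineq2[of "u s" "w s"]
        by (intro order_trans[OF abs_triangle_ineq4]) (simp add: dot_square_norm)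
      also have "\<dots> \<le> 2 * (norm (u s))\<^sup>2 + (norm (w s))\<^sup>2"
        using zero_le_power2[of "norm (u s) - norm (w s)"]
          mult_nonneg_nonneg[OF norm_ge_zero norm_ge_zero, of "u s" "w s"]
        unfolding power2_diff by linarith
      finally show ?thesis .
    qed
    then show "AE s in ?M. norm (inner (u s) (\<delta> s)) \<le> norm (2 * (norm (u s))\<^sup>2 + (norm (w s))\<^sup>2)"
      by (intro AE_I2) (metis abs_ge_self order_trans real_norm_def)
  qed
  \<comment> \<open>After Fubini, the costate formula produces
    \<open>b * p s * inner (\<delta> s) (y s)\<close>, which \<open>inner (u s) (\<delta> s)\<close>
    cancels because \<open>u = - b p y\<close>. What survives is the terminal term, with its sign
    reversed.\<close>
  have first_variation: "(LINT t|?M. q * inner (y t) (\<eta> t) + inner (u t) (\<delta> t)) = - z * inner (y T) (\<eta> T)"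
  proof -
    have "(LINT t|?M. q * inner (y t) (\<eta> t) + inner (u t) (\<delta> t))
      = q * (LINT t|?M. inner (y t) (\<eta> t)) + (LINT t|?M. inner (u t) (\<delta> t))"
      using fub(1) u\<delta> by simp
    also have "\<dots> = (LINT s|?M. q * (LINT t|lebesgue_on {s..T}. exp ((t - s) * a) * b * inner (y t) (\<delta> s))
        + inner (u s) (\<delta> s))"
      unfolding fub(3) using fub(2) u\<delta> by simp
    also have "\<dots> = (LINT s|?M. - z * (exp ((T - s) * a) * b * inner (y T) (\<delta> s)))"
    proof (rule Bochner_Integration.integral_cong[OF refl])
      fix s assume "s \<in> space ?M"
      then have s: "s \<in> {0..T}" by simp
      have "(LINT t|lebesgue_on {s..T}. exp ((t - s) * a) * b * inner (y t) (\<delta> s))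
          = (LINT t|lebesgue_on {s..T}. b * (exp ((t - s) * a) * inner (\<delta> s) (y t)))"
        by (simp add: inner_commute mult_ac)
      also have "\<dots> = b * (LINT t|lebesgue_on {s..T}. exp ((t - s) * a) * inner (\<delta> s) (y t))"
        by simp
      finally have "q * (LINT t|lebesgue_on {s..T}. exp ((t - s) * a) * b * inner (y t) (\<delta> s))
          = b * (q * (LINT t|lebesgue_on {s..T}. exp ((t - s) * a) * inner (\<delta> s) (y t)))" by simp
      also have "\<dots> = b * (p s * inner (\<delta> s) (y s) - exp ((T - s) * a) * z * inner (\<delta> s) (y T))"
        using costate[OF s, of "\<delta> s"] by simp
      finally show "q * (LINT t|lebesgue_on {s..T}. exp ((t - s) * a) * b * inner (y t) (\<delta> s)) + inner (u s) (\<delta> s)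
          = - z * (exp ((T - s) * a) * b * inner (y T) (\<delta> s))"
        by (simp add: u_def inner_commute algebra_simps)
    qed
    also have "\<dots> = - z * inner (y T) (\<eta> T)" unfolding \<eta>T by simp
    finally show ?thesis .
  qed
  \<comment> \<open>The tangent inequality, obtained by discarding the term quadratic in the
    increment; it is applied with c = q, c = 1 and c = z.\<close>
  have convex: "c * (norm (v1 + v2))\<^sup>2 \<ge> c * (norm v1)\<^sup>2 + 2 * (c * inner v1 v2)" if "0 \<le> c" for c and v1 v2 :: 'h
  proof -
    have "c * (norm (v1 + v2))\<^sup>2 = c * (norm v1)\<^sup>2 + 2 * (c * inner v1 v2) + c * (norm v2)\<^sup>2"
      by (simp add: power2_norm_eq_inner inner_add_left inner_add_right inner_commute algebra_simps)
    then show ?thesis using that by simp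
  qed
  have iu: "integrable ?M (\<lambda>t. q * (norm (mode a b y0 u t))\<^sup>2 + (norm (u t))\<^sup>2)"
    by (rule mode_cost_integrable[OF ua])
  have iw: "integrable ?M (\<lambda>t. q * (norm (mode a b y0 w t))\<^sup>2 + (norm (w t))\<^sup>2)"
    by (rule mode_cost_integrable[OF w])
  have iv: "integrable ?M (\<lambda>t. q * inner (y t) (\<eta> t) + inner (u t) (\<delta> t))"
    using fub(1) u\<delta> by simp
  have iv2: "integrable ?M (\<lambda>t. 2 * (q * inner (y t) (\<eta> t) + inner (u t) (\<delta> t)))"
    using iv by (intro integrable_mult_right)
  have "(LINT t|?M. q * (norm (mode a b y0 u t))\<^sup>2 + (norm (u t))\<^sup>2) - 2 * (z * inner (y T) (\<eta> T))
    = (LINT t|?M. (q * (norm (mode a b y0 u t))\<^sup>2 + (norm (u t))\<^sup>2)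
        + 2 * (q * inner (y t) (\<eta> t) + inner (u t) (\<delta> t)))"
    unfolding Bochner_Integration.integral_add[OF iu iv2] integral_mult_right_zero first_variation by simp
  also have "\<dots> \<le> (LINT t|?M. q * (norm (mode a b y0 w t))\<^sup>2 + (norm (w t))\<^sup>2)"
  proof (intro Bochner_Integration.integral_mono iw)
    show "integrable ?M (\<lambda>t. (q * (norm (mode a b y0 u t))\<^sup>2 + (norm (u t))\<^sup>2)
        + 2 * (q * inner (y t) (\<eta> t) + inner (u t) (\<delta> t)))"
      by (rule Bochner_Integration.integrable_add[OF iu iv2])
    fix t assume "t \<in> space ?M"
    then have t: "t \<in> {0..T}" by simp
    have "w t = u t + \<delta> t" by (simp add: \<delta>_def)
    then show "(q * (norm (mode a b y0 u t))\<^sup>2 + (norm (u t))\<^sup>2)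
        + 2 * (q * inner (y t) (\<eta> t) + inner (u t) (\<delta> t)) \<le> q * (norm (mode a b y0 w t))\<^sup>2 + (norm (w t))\<^sup>2"
      using convex[OF nonneg(1), of "y t" "\<eta> t"] convex[of 1 "u t" "\<delta> t"] w_eq[OF t] y_eq[OF t] by simp
  qed
  finally show ?thesis
    using convex[OF nonneg(2), of "y T" "\<eta> T"] w_eq[OF T] y_eq[OF T] by simp
qed

section \<open>Diagonal operators\<close>

lemma norm_oppow_le: "norm (oppow K n) \<le> norm K ^ n"
proof (induction n)
  case 0
  show ?case by (simp add: norm_blinfun_id_le)
next
  case (Suc n)
  have "norm (oppow K (Suc n)) \<le> norm K * norm (oppow K n)"
    by (simp add: norm_blinfun_compose)
  also have "\<dots> \<le> norm K * norm K ^ n" using Suc by (intro mult_left_mono) auto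
  finally show ?case by simp
qed

text \<open>\<open>opexp\<close> is an infinite sum in operator norm, so its value is meaningful
  only once summability is known. Comparison with the real exponential series provides this, and
  evaluation at v is continuous.\<close>

lemma opexp_apply_sums:
  fixes K :: "'a::banach \<Rightarrow>\<^sub>L 'a"
  shows "(\<lambda>n. (1 / fact n) *\<^sub>R blinfun_apply (oppow K n) v) sums blinfun_apply (opexp K) v"
proof -
  have "summable (\<lambda>n. (1 / fact n) *\<^sub>R oppow K n)"
  proof (rule summable_comparison_test')
    show "summable (\<lambda>n. norm K ^ n /\<^sub>R fact n)" by (rule summable_exp_generic)
    show "norm ((1 / fact n) *\<^sub>R oppow K n) \<le> norm K ^ n /\<^sub>R fact n" for n
      using norm_oppow_le[of K n] by (simp add: divide_inverse mult_left_mono)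
  qed
  then have "(\<lambda>n. (1 / fact n) *\<^sub>R oppow K n) sums opexp K"
    unfolding opexp_def by (rule summable_sums)
  from bounded_linear.sums[OF blinfun.bounded_linear_left this, of v]
  show ?thesis by (simp add: blinfun.scaleR_left)
qed

text \<open>A finite orthogonal resolution of the identity: d + 1 mutually annihilating self-adjoint
  idempotents that add up to the identity. The control problem is solved from these axioms,
  separately from the realisation on the unit interval.\<close>

locale spectral_resolution =
  fixes d :: nat and P :: "nat \<Rightarrow> 'h \<Rightarrow> 'h::{real_inner,banach,second_countable_topology}"
  assumes bounded_linear_P: "l \<le> d \<Longrightarrow> bounded_linear (P l)"
    and P_P: "i \<le> d \<Longrightarrow> j \<le> d \<Longrightarrow> P i (P j v) = (if i = j then P j v else 0)"
    and P_sym: "l \<le> d \<Longrightarrow> inner (P l v) w = inner v (P l w)"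
    and sum_P: "(\<Sum>l\<le>d. P l v) = v"
begin

text \<open>A relation and not a function of K, since K determines \<open>k l\<close> only where
  \<open>P l\<close> is nonzero. The lemmas that follow form the functional calculus of such
  operators.\<close>

definition diag :: "('h \<Rightarrow>\<^sub>L 'h) \<Rightarrow> (nat \<Rightarrow> real) \<Rightarrow> bool" where
  "diag K k \<longleftrightarrow> (\<forall>v. blinfun_apply K v = (\<Sum>l\<le>d. k l *\<^sub>R P l v))"

lemma P_combination:
  assumes "i \<le> d" shows "P i (\<Sum>l\<le>d. c l *\<^sub>R P l (v l)) = c i *\<^sub>R P i (v i)"
proof -
  interpret bounded_linear "P i" by (rule bounded_linear_P[OF assms])
  have "P i (\<Sum>l\<le>d. c l *\<^sub>R P l (v l)) = (\<Sum>l\<le>d. if i = l then c l *\<^sub>R P l (v l) else 0)"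
    unfolding sum scaleR using P_P[OF assms] by (intro sum.cong) auto
  then show ?thesis using assms by simp
qed

lemma P_eqI: "(\<And>l. l \<le> d \<Longrightarrow> P l v = P l w) \<Longrightarrow> v = w"
  using sum_P[of v] sum_P[of w] by (metis (no_types, lifting) atMost_iff sum.cong)

lemma inner_eq_sum: "inner v w = (\<Sum>l\<le>d. inner (P l v) (P l w))"
proof -
  have "inner v w = inner v (\<Sum>l\<le>d. P l w)" by (simp add: sum_P)
  also have "\<dots> = (\<Sum>l\<le>d. inner v (P l (P l w)))" unfolding inner_sum_right by (simp add: P_P)
  finally show ?thesis by (simp add: P_sym)
qed

lemma diag_P: "diag K k \<Longrightarrow> l \<le> d \<Longrightarrow> P l (blinfun_apply K v) = k l *\<^sub>R P l v"
  using P_combination[of l k "\<lambda>_. v"] by (simp add: diag_def)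

lemma diag_id: "diag id_blinfun (\<lambda>_. 1)"
  by (simp add: diag_def sum_P)

lemma diag_scaleR: "diag K k \<Longrightarrow> diag (c *\<^sub>R K) (\<lambda>l. c * k l)"
  by (simp add: diag_def blinfun.scaleR_left scaleR_sum_right)

lemma diag_add: "diag K k \<Longrightarrow> diag L l \<Longrightarrow> diag (K + L) (\<lambda>i. k i + l i)"
  by (simp add: diag_def blinfun.add_left sum.distrib scaleR_add_left)

lemma diag_oppow: "diag K k \<Longrightarrow> diag (oppow K n) (\<lambda>l. k l ^ n)"
proof (induction n)
  case 0
  then show ?case using diag_id by simp
next
  case (Suc n)
  then have IH: "diag (oppow K n) (\<lambda>l. k l ^ n)" by simp
  show ?case unfolding diag_def
  proof
    fix v
    have "blinfun_apply (oppow K (Suc n)) v = (\<Sum>l\<le>d. k l *\<^sub>R P l (blinfun_apply (oppow K n) v))"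
      using Suc.prems by (simp add: diag_def)
    also have "\<dots> = (\<Sum>l\<le>d. k l ^ Suc n *\<^sub>R P l v)"
      using diag_P[OF IH] by (intro sum.cong) auto
    finally show "blinfun_apply (oppow K (Suc n)) v = (\<Sum>l\<le>d. k l ^ Suc n *\<^sub>R P l v)" .
  qed
qed

lemma diag_oppoly:
  assumes "diag K k" shows "diag (oppoly c n K) (\<lambda>l. rpoly c n (k l))"
  unfolding diag_def
proof
  fix v
  have "blinfun_apply (oppoly c n K) v = (\<Sum>i\<le>n. \<Sum>l\<le>d. (c i * k l ^ i) *\<^sub>R P l v)"
    using diag_oppow[OF assms] by (simp add: oppoly_def diag_def blinfun.sum_left blinfun.scaleR_left scaleR_sum_right)
  also have "\<dots> = (\<Sum>l\<le>d. \<Sum>i\<le>n. (c i * k l ^ i) *\<^sub>R P l v)" by (rule sum.swap)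
  finally show "blinfun_apply (oppoly c n K) v = (\<Sum>l\<le>d. rpoly c n (k l) *\<^sub>R P l v)"
    by (simp add: rpoly_def scaleR_sum_left)
qed

lemma diag_opexp:
  assumes "diag K k" shows "diag (opexp K) (\<lambda>l. exp (k l))"
  unfolding diag_def
proof
  fix v
  have "(\<lambda>n. \<Sum>l\<le>d. (k l ^ n /\<^sub>R fact n) *\<^sub>R P l v) sums (\<Sum>l\<le>d. exp (k l) *\<^sub>R P l v)"
    by (intro sums_sum bounded_linear.sums[OF bounded_linear_scaleR_left] exp_converges)
  moreover have "(\<Sum>l\<le>d. (k l ^ n /\<^sub>R fact n) *\<^sub>R P l v) = (1 / fact n) *\<^sub>R blinfun_apply (oppow K n) v" for n
    using diag_oppow[OF assms, of n] by (simp add: diag_def scaleR_sum_right divide_inverse)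
  ultimately show "blinfun_apply (opexp K) v = (\<Sum>l\<le>d. exp (k l) *\<^sub>R P l v)"
    using opexp_apply_sums[of K v] sums_unique2 by simp
qed

lemma diag_inner: "diag K k \<Longrightarrow> inner v (blinfun_apply K v) = (\<Sum>l\<le>d. k l * (norm (P l v))\<^sup>2)"
  by (subst inner_eq_sum) (simp add: diag_P power2_norm_eq_inner)

lemma norm_sq_eq_sum: "(norm v)\<^sup>2 = (\<Sum>l\<le>d. (norm (P l v))\<^sup>2)"
  using inner_eq_sum[of v v] by (simp add: power2_norm_eq_inner)

lemma norm_P_le:
  assumes "l \<le> d" shows "norm (P l v) \<le> norm v"
proof -
  have "(norm (P l v))\<^sup>2 \<le> (\<Sum>l\<le>d. (norm (P l v))\<^sup>2)"
    using assms by (intro member_le_sum) auto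
  also have "\<dots> = (norm v)\<^sup>2" by (rule norm_sq_eq_sum[symmetric])
  finally show ?thesis by (simp add: power2_le_iff_abs_le)
qed

lemma admissible_P:
  assumes l: "l \<le> d" and u: "admissible T u"
  shows "admissible T (\<lambda>s. P l (u s))"
  unfolding admissible_def
proof
  have "continuous_on UNIV (P l)" by (rule linear_continuous_on[OF bounded_linear_P[OF l]])
  then have [measurable]: "P l \<in> borel_measurable borel" by (rule borel_measurable_continuous_onI)
  have [measurable]: "u \<in> borel_measurable (lebesgue_on {0..T})" using u by (simp add: admissible_def)
  show "(\<lambda>s. P l (u s)) \<in> borel_measurable (lebesgue_on {0..T})" by measurable
  show "integrable (lebesgue_on {0..T}) (\<lambda>t. (norm (P l (u t)))\<^sup>2)"
  proof (rule Bochner_Integration.integrable_bound)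
    show "integrable (lebesgue_on {0..T}) (\<lambda>t. (norm (u t))\<^sup>2)" using u by (simp add: admissible_def)
    show "AE t in lebesgue_on {0..T}. norm ((norm (P l (u t)))\<^sup>2) \<le> norm ((norm (u t))\<^sup>2)"
      using norm_P_le[OF l] by (intro AE_I2) (simp add: power_mono)
  qed measurable
qed

lemma P_mild:
  assumes AA: "diag AA a" and BB: "diag BB b"
    and u: "integrable (lebesgue_on {0..T}) u" and t: "t \<in> {0..T}" and l: "l \<le> d"
  shows "P l (mild AA BB x0 u t) = mode (a l) (b l) (P l x0) (\<lambda>s. P l (u s)) t"
proof -
  let ?g = "\<lambda>s. blinfun_apply (opexp ((t - s) *\<^sub>R AA)) (blinfun_apply BB (u s))"
  have E: "diag (opexp (r *\<^sub>R AA)) (\<lambda>l. exp (r * a l))" for r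
    by (intro diag_opexp diag_scaleR AA)
  have g: "?g s = (\<Sum>l\<le>d. (exp ((t - s) * a l) * b l) *\<^sub>R P l (u s))" for s
    using E[of "t - s"] diag_P[OF BB] by (simp add: diag_def)
  \<comment> \<open>Integrability has to be known before \<open>P l\<close> may be moved under the
    Bochner integral; the integrand is a finite sum of modal kernels, each of them
    integrable.\<close>
  have int: "integrable (lebesgue_on {0..t}) ?g"
    unfolding g using t
    by (intro Bochner_Integration.integrable_sum kernel_integrable[where T = T]
        integrable_bounded_linear[OF bounded_linear_P u]) auto
  interpret P: bounded_linear "P l" by (rule bounded_linear_P[OF l])
  have "P l (mild AA BB x0 u t) = P l (blinfun_apply (opexp (t *\<^sub>R AA)) x0) + P l (LINT s|lebesgue_on {0..t}. ?g s)"
    by (simp add: mild_def P.add)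
  also have "P l (LINT s|lebesgue_on {0..t}. ?g s) = (LINT s|lebesgue_on {0..t}. P l (?g s))"
    by (rule integral_bounded_linear[OF bounded_linear_P[OF l] int, symmetric])
  also have "(\<lambda>s. P l (?g s)) = (\<lambda>s. (exp ((t - s) * a l) * b l) *\<^sub>R P l (u s))"
    unfolding g by (simp add: P_combination[OF l])
  finally show ?thesis by (simp add: mode_def diag_P[OF E l])
qed

text \<open>Orthogonality removes all mixed terms from the quadratic forms, and each modal cost is
  integrable by itself, so the finite sum leaves the integral.\<close>

lemma cost_eq_sum_modes:
  assumes AA: "diag AA a" and BB: "diag BB b" and Q: "diag Q q" and P0: "diag P0 z"
    and T: "0 \<le> T" and u: "admissible T u"
  shows "cost AA BB Q P0 T x0 u = (\<Sum>l\<le>d.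
     (LINT t|lebesgue_on {0..T}. q l * (norm (mode (a l) (b l) (P l x0) (\<lambda>s. P l (u s)) t))\<^sup>2 + (norm (P l (u t)))\<^sup>2)
      + z l * (norm (mode (a l) (b l) (P l x0) (\<lambda>s. P l (u s)) T))\<^sup>2)"
proof -
  let ?y = "\<lambda>l. mode (a l) (b l) (P l x0) (\<lambda>s. P l (u s))"
  note Pm = P_mild[OF AA BB admissible_integrable[OF u]]
  have "(LINT t|lebesgue_on {0..T}. inner (mild AA BB x0 u t) (blinfun_apply Q (mild AA BB x0 u t)) + inner (u t) (u t))
     = (LINT t|lebesgue_on {0..T}. (\<Sum>l\<le>d. q l * (norm (?y l t))\<^sup>2 + (norm (P l (u t)))\<^sup>2))"
    by (intro Bochner_Integration.integral_cong refl)
      (simp add: diag_inner[OF Q] Pm sum.distrib dot_square_norm norm_sq_eq_sum[of "u _"])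
  also have "\<dots> = (\<Sum>l\<le>d. LINT t|lebesgue_on {0..T}. q l * (norm (?y l t))\<^sup>2 + (norm (P l (u t)))\<^sup>2)"
    by (intro Bochner_Integration.integral_sum mode_cost_integrable admissible_P u) auto
  finally show ?thesis
    using T by (simp add: cost_def diag_inner[OF P0] Pm sum.distrib)
qed

text \<open>The projections of an admissible competitor are admissible competitors in the single
  modes, so the inequality holds term by term, with no constraint linking the modes.\<close>

lemma feedback_optimal:
  assumes AA: "diag AA a" and BB: "diag BB b" and Q: "diag Q q" and P0: "diag P0 z"
    and T: "0 \<le> T"
    and nonneg: "\<And>l. l \<le> d \<Longrightarrow> 0 \<le> q l" "\<And>l. l \<le> d \<Longrightarrow> 0 \<le> z l"
    and p: "\<And>l. l \<le> d \<Longrightarrow> p l T = z l"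
      "\<And>l t. l \<le> d \<Longrightarrow> t \<in> {0..T} \<Longrightarrow> (p l has_real_derivative
          - (2 * a l * p l t) + (b l)\<^sup>2 * (p l t)\<^sup>2 - q l) (at t within {0..T})"
    and x: "continuous_on {0..T} x" "\<And>t. t \<in> {0..T} \<Longrightarrow> x t = mild AA BB x0 u t"
    and u: "\<And>s. u s = (\<Sum>l\<le>d. (- (b l * p l s)) *\<^sub>R P l (x s))"
  shows "admissible T u"
    and "admissible T v \<Longrightarrow> cost AA BB Q P0 T x0 u \<le> cost AA BB Q P0 T x0 v"
proof -
  have Pc: "continuous_on {0..T} (\<lambda>s. P l (x s))" if "l \<le> d" for l
    by (rule bounded_linear.continuous_on[OF bounded_linear_P[OF that] x(1)])
  have "continuous_on {0..T} u"
    unfolding u by (intro continuous_intros Pc DERIV_continuous_on[OF p(2)]) auto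
  then show ua: "admissible T u" by (rule admissible_continuous)
  have Pu: "P l (u s) = (- (b l * p l s)) *\<^sub>R P l (x s)" if "l \<le> d" for l s
    unfolding u by (rule P_combination[OF that])
  assume v: "admissible T v"
  show "cost AA BB Q P0 T x0 u \<le> cost AA BB Q P0 T x0 v"
    unfolding cost_eq_sum_modes[OF AA BB Q P0 T ua] cost_eq_sum_modes[OF AA BB Q P0 T v]
  proof (rule sum_mono)
    fix l assume "l \<in> {..d}"
    then have l: "l \<le> d" by simp
    show "(LINT t|lebesgue_on {0..T}. q l * (norm (mode (a l) (b l) (P l x0) (\<lambda>s. P l (u s)) t))\<^sup>2 + (norm (P l (u t)))\<^sup>2)
        + z l * (norm (mode (a l) (b l) (P l x0) (\<lambda>s. P l (u s)) T))\<^sup>2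
      \<le> (LINT t|lebesgue_on {0..T}. q l * (norm (mode (a l) (b l) (P l x0) (\<lambda>s. P l (v s)) t))\<^sup>2 + (norm (P l (v t)))\<^sup>2)
        + z l * (norm (mode (a l) (b l) (P l x0) (\<lambda>s. P l (v s)) T))\<^sup>2"
      unfolding Pu[OF l]
    proof (rule lq_mode_optimal[OF Pc[OF l] _ p(1)[OF l] p(2)[OF l] nonneg(1)[OF l] nonneg(2)[OF l] T admissible_P[OF l v]])
      show "P l (x t) = mode (a l) (b l) (P l x0) (\<lambda>s. (- (b l * p l s)) *\<^sub>R P l (x s)) t" if "t \<in> {0..T}" for t
        using P_mild[OF AA BB admissible_integrable[OF ua] that l] x(2)[OF that] by (simp add: Pu[OF l])
    qed
  qed
qed

lemma closed_loop_exists: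
  assumes AA: "diag AA a" and BB: "diag BB b"
    and p: "\<And>l. l \<le> d \<Longrightarrow> continuous_on {0..T} (p l)"
    and \<rho>: "\<And>l. l \<le> d \<Longrightarrow> \<rho> l 0 = 1"
      "\<And>l t. l \<le> d \<Longrightarrow> t \<in> {0..T} \<Longrightarrow> (\<rho> l has_real_derivative
          (a l - (b l)\<^sup>2 * p l t) * \<rho> l t) (at t within {0..T})"
  obtains x where "continuous_on {0..T} x"
    "\<And>t. t \<in> {0..T} \<Longrightarrow> x t = mild AA BB x0 (\<lambda>s. \<Sum>l\<le>d. (- (b l * p l s)) *\<^sub>R P l (x s)) t"
proof
  define x where "x t = (\<Sum>l\<le>d. \<rho> l t *\<^sub>R P l x0)" for t
  have \<rho>c: "continuous_on {0..T} (\<rho> l)" if "l \<le> d" for l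
    by (rule DERIV_continuous_on[OF \<rho>(2)[OF that]])
  show "continuous_on {0..T} x" unfolding x_def by (intro continuous_intros \<rho>c) auto
  let ?u = "\<lambda>s. \<Sum>l\<le>d. (- (b l * p l s)) *\<^sub>R P l (x s)"
  have Px: "P l (x s) = \<rho> l s *\<^sub>R P l x0" if "l \<le> d" for l s
    unfolding x_def by (rule P_combination[OF that])
  have Pu: "P l (?u s) = (- (b l * p l s) * \<rho> l s) *\<^sub>R P l x0" if "l \<le> d" for l s
    using P_combination[OF that, of "\<lambda>l. - (b l * p l s)" "\<lambda>_. x s"] Px[OF that] by simp
  have "continuous_on {0..T} ?u"
    by (intro continuous_on_sum continuous_on_scaleR bounded_linear.continuous_on[OF bounded_linear_P]
        continuous_on_minus continuous_on_mult continuous_on_const p \<open>continuous_on {0..T} x\<close>) auto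
  then have u: "integrable (lebesgue_on {0..T}) ?u"
    by (intro admissible_integrable admissible_continuous)
  fix t assume t: "t \<in> {0..T}"
  show "x t = mild AA BB x0 ?u t"
  proof (rule P_eqI)
    fix l assume l: "l \<le> d"
    \<comment> \<open>The derivative of F in s is exactly the integrand k: the exponential
      contributes \<open>- a l\<close>, which cancels the uncontrolled part of the growth rate of
      \<open>\<rho> l\<close>.\<close>
    define F where "F s = exp ((t - s) * a l) * \<rho> l s" for s
    define k where "k s = exp ((t - s) * a l) * b l * (- (b l * p l s) * \<rho> l s)" for s
    have kc: "continuous_on {0..t} k" unfolding k_def
      using t by (intro continuous_intros continuous_on_subset[OF p[OF l]] continuous_on_subset[OF \<rho>c[OF l]]) auto
    have "(LINT s|lebesgue_on {0..t}. k s) = F t - F 0"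
    proof (rule integral_lebesgue_on_FTC[OF _ kc])
      fix s assume s: "s \<in> {0..t}"
      then have "s \<in> {0..T}" using t by auto
      note d = DERIV_subset[OF \<rho>(2)[OF l this], of "{0..t}"]
      show "(F has_real_derivative k s) (at s within {0..t})"
        unfolding F_def k_def using t
        by (auto intro!: derivative_eq_intros d simp: algebra_simps power2_eq_square)
    qed (use t in auto)
    then have K: "(LINT s|lebesgue_on {0..t}. k s) = \<rho> l t - exp (t * a l)"
      using \<rho>(1)[OF l] by (simp add: F_def)
    have "P l (mild AA BB x0 ?u t) = exp (t * a l) *\<^sub>R P l x0 + (LINT s|lebesgue_on {0..t}. k s *\<^sub>R P l x0)"
      unfolding P_mild[OF AA BB u t l] mode_def Pu[OF l] by (simp add: k_def)
    also have "(LINT s|lebesgue_on {0..t}. k s *\<^sub>R P l x0) = (LINT s|lebesgue_on {0..t}. k s) *\<^sub>R P l x0"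
      by (rule integral_scaleR_left) (rule continuous_imp_integrable_real[OF kc])
    finally show "P l (x t) = P l (mild AA BB x0 ?u t)"
      unfolding K by (simp add: Px[OF l] scaleR_left_diff_distrib)
  qed
qed

end

section \<open>Finite-rank kernels on the unit interval\<close>

lemma L2_product_integrable:
  assumes "L2fun g" "L2fun h"
  shows "integrable (lebesgue_on {0..1}) (\<lambda>\<xi>. g \<xi> * h \<xi>)"
proof (rule Bochner_Integration.integrable_bound)
  note [measurable] = assms[unfolded L2fun_def, THEN conjunct1]
  show "integrable (lebesgue_on {0..1}) (\<lambda>\<xi>. (g \<xi>)\<^sup>2 + (h \<xi>)\<^sup>2)"
    using assms by (simp add: L2fun_def)
  show "(\<lambda>\<xi>. g \<xi> * h \<xi>) \<in> borel_measurable (lebesgue_on {0..1})" by measurable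
  have "\<bar>g \<xi> * h \<xi>\<bar> \<le> (g \<xi>)\<^sup>2 + (h \<xi>)\<^sup>2" for \<xi>
  proof -
    have "2 * (\<bar>g \<xi>\<bar> * \<bar>h \<xi>\<bar>) \<le> (g \<xi>)\<^sup>2 + (h \<xi>)\<^sup>2"
      using zero_le_power2[of "\<bar>g \<xi>\<bar> - \<bar>h \<xi>\<bar>"] by (simp add: power2_diff)
    then show ?thesis using mult_nonneg_nonneg[OF abs_ge_zero abs_ge_zero, of "g \<xi>" "h \<xi>"]
      unfolding abs_mult by linarith
  qed
  then show "AE \<xi> in lebesgue_on {0..1}. norm (g \<xi> * h \<xi>) \<le> norm ((g \<xi>)\<^sup>2 + (h \<xi>)\<^sup>2)"
    by (intro AE_I2) (metis abs_ge_self order_trans real_norm_def)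
qed

text \<open>Lebesgue measure on the plane is the completion of the product of the Borel measures.
  The null set is therefore sliced in the Borel product, and the sections are carried back to the
  completed measure on the line.\<close>

lemma AE_lebesgue_square_sections:
  assumes "AE p in lebesgue_on ({0..1::real} \<times> {0..1::real}). R (fst p) (snd p)"
  shows "AE x in lebesgue_on {0..1}. AE y in lebesgue_on {0..1}. R x y"
proof -
  have "{0..1::real} \<times> {0..1::real} = cbox (0, 0) (1, 1)" by (simp add: cbox_Pair_eq)
  then have "{0..1::real} \<times> {0..1::real} \<in> sets lebesgue" by simp
  then have "AE p in lebesgue. p \<in> {0..1::real} \<times> {0..1::real} \<longrightarrow> R (fst p) (snd p)"
    using assms by (simp add: AE_restrict_space_iff)
  then have "AE p in lborel \<Otimes>\<^sub>M lborel. p \<in> {0..1::real} \<times> {0..1::real} \<longrightarrow> R (fst p) (snd p)"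
    unfolding AE_completion_iff lborel_prod .
  from lborel_pair.AE_pair[OF this]
  have "AE x in lborel. AE y in lborel. (x, y) \<in> {0..1} \<times> {0..1} \<longrightarrow> R x y" by simp
  then have "AE x in lborel. x \<in> {0..1} \<longrightarrow> (AE y in lborel. y \<in> {0..1} \<longrightarrow> R x y)"
  proof (rule eventually_mono)
    fix x :: real
    assume "AE y in lborel. (x, y) \<in> {0..1} \<times> {0..1} \<longrightarrow> R x y"
    then show "x \<in> {0..1} \<longrightarrow> (AE y in lborel. y \<in> {0..1} \<longrightarrow> R x y)"
      by (intro impI) (rule eventually_mono, auto)
  qed
  then have "AE x in lebesgue. x \<in> {0..1} \<longrightarrow> (AE y in lborel. y \<in> {0..1} \<longrightarrow> R x y)"
    by (rule AE_completion)
  then have "AE x in lebesgue. x \<in> {0..1} \<longrightarrow> (AE y in lebesgue. y \<in> {0..1} \<longrightarrow> R x y)"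
    by (rule eventually_mono) (blast intro: AE_completion)
  then show ?thesis by (simp add: AE_restrict_space_iff)
qed

text \<open>An effect of the completeness of Lebesgue measure. It supplies the measurability of
  almost every section of the kernel, through its agreement with a finite-rank expression.\<close>

lemma borel_measurable_lebesgue_on_AE:
  fixes g h :: "real \<Rightarrow> real"
  assumes "g \<in> borel_measurable (lebesgue_on S)" "AE x in lebesgue_on S. g x = h x" "S \<in> sets lebesgue"
  shows "h \<in> borel_measurable (lebesgue_on S)"
proof -
  have "(\<lambda>x. if x \<in> S then g x else 0) \<in> borel_measurable lebesgue"
    using assms by (simp add: borel_measurable_if)
  moreover have "AE x in lebesgue. (if x \<in> S then g x else 0) = (if x \<in> S then h x else 0)"
    using assms(2,3) by (subst (asm) AE_restrict_space_iff) (auto elim: eventually_mono)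
  ultimately have "(\<lambda>x. if x \<in> S then h x else 0) \<in> borel_measurable lebesgue"
    by (rule borel_measurable_AE)
  then show ?thesis using assms(3) by (simp add: borel_measurable_if)
qed

text \<open>The expansion of the kernel holds almost everywhere on the square, hence for almost
  every x it holds for almost every y, and there the integral against \<open>emb v\<close> reduces
  to the coefficients \<open>inner v (f l)\<close>.\<close>

lemma integral_operator_finite_rank:
  fixes emb :: "'h::real_inner \<Rightarrow> (real \<Rightarrow> real)"
  assumes model: "L2_model emb" and op: "is_integral_operator emb K Op"
    and rep: "AE p in lebesgue_on ({0..1} \<times> {0..1}).
         K (fst p) (snd p) = (\<Sum>l\<in>I. c l * emb (f l) (fst p) * emb (f l) (snd p))"
  shows "blinfun_apply Op v = (\<Sum>l\<in>I. c l *\<^sub>R (inner v (f l) *\<^sub>R f l))"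
proof -
  let ?M = "lebesgue_on {0..1}"
  have L2: "L2fun (emb w)" and in_eq: "inner w w' = (LINT \<xi>|?M. emb w \<xi> * emb w' \<xi>)" for w w'
    using model by (auto simp: L2_model_def)
  have [measurable]: "emb w \<in> borel_measurable ?M" for w using L2[of w] by (simp add: L2fun_def)
  have int: "integrable ?M (\<lambda>\<xi>. emb w \<xi> * emb w' \<xi>)" for w w' by (intro L2_product_integrable L2)
  have kernel: "(LINT y|?M. K x y * emb v y) = (\<Sum>l\<in>I. c l * inner v (f l) * emb (f l) x)"
    if "AE y in ?M. K x y = (\<Sum>l\<in>I. c l * emb (f l) x * emb (f l) y)" for x
  proof -
    have ae: "AE y in ?M. (\<Sum>l\<in>I. c l * emb (f l) x * (emb v y * emb (f l) y)) = K x y * emb v y"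
      using that by eventually_elim (simp add: sum_distrib_left sum_distrib_right mult_ac)
    have meas: "(\<lambda>y. \<Sum>l\<in>I. c l * emb (f l) x * (emb v y * emb (f l) y)) \<in> borel_measurable ?M"
      by measurable
    have "(LINT y|?M. K x y * emb v y) = (LINT y|?M. (\<Sum>l\<in>I. c l * emb (f l) x * (emb v y * emb (f l) y)))"
      by (rule integral_cong_AE[symmetric, OF meas borel_measurable_lebesgue_on_AE[OF meas ae] ae]) simp
    also have "\<dots> = (\<Sum>l\<in>I. LINT y|?M. c l * emb (f l) x * (emb v y * emb (f l) y))"
      by (intro Bochner_Integration.integral_sum integrable_mult_right int)
    also have "\<dots> = (\<Sum>l\<in>I. c l * inner v (f l) * emb (f l) x)"
      unfolding integral_mult_right_zero in_eq by (simp add: mult_ac)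
    finally show ?thesis .
  qed
  have ae: "AE x in ?M. emb (blinfun_apply Op v) x = (\<Sum>l\<in>I. c l * inner v (f l) * emb (f l) x)"
    using AE_lebesgue_square_sections[OF rep] op[unfolded is_integral_operator_def, rule_format, of v]
    by eventually_elim (simp add: kernel)
  \<comment> \<open>\<open>L2_model\<close> records inner products but not linearity of
    \<open>emb\<close>, so the two vectors are compared by testing against every w; choosing w as
    their difference makes it vanish.\<close>
  have "inner (blinfun_apply Op v) w = inner (\<Sum>l\<in>I. c l *\<^sub>R (inner v (f l) *\<^sub>R f l)) w" for w
  proof -
    have "inner (blinfun_apply Op v) w
        = (LINT x|?M. (\<Sum>l\<in>I. (c l * inner v (f l)) * (emb (f l) x * emb w x)))"
      unfolding in_eq[of "blinfun_apply Op v" w]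
    proof (rule integral_cong_AE)
      show "AE x in ?M. emb (blinfun_apply Op v) x * emb w x
          = (\<Sum>l\<in>I. c l * inner v (f l) * (emb (f l) x * emb w x))"
        using ae by eventually_elim (simp add: sum_distrib_left sum_distrib_right mult_ac)
    qed measurable
    also have "\<dots> = (\<Sum>l\<in>I. c l * inner v (f l) * inner (f l) w)"
      using int by (subst Bochner_Integration.integral_sum) (auto simp: in_eq[of "f _" w])
    finally show ?thesis by (simp add: inner_sum_left mult.assoc)
  qed
  from this[of "blinfun_apply Op v - (\<Sum>l\<in>I. c l *\<^sub>R (inner v (f l) *\<^sub>R f l))"]
  have "inner (blinfun_apply Op v - (\<Sum>l\<in>I. c l *\<^sub>R (inner v (f l) *\<^sub>R f l)))
      (blinfun_apply Op v - (\<Sum>l\<in>I. c l *\<^sub>R (inner v (f l) *\<^sub>R f l))) = 0"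
    by (subst inner_diff_left) simp
  then show ?thesis by simp
qed

text \<open>Indicator functions of the disjoint intervals (1/(i+2), 1/(i+1)] are represented by
  nonzero, pairwise orthogonal vectors, and arbitrarily many of these are independent.\<close>

lemma L2_model_infinite_dimensional:
  fixes emb :: "'h::real_inner \<Rightarrow> (real \<Rightarrow> real)"
  assumes model: "L2_model emb" and S: "finite (S :: 'h set)"
  shows "\<exists>v. v \<notin> span S"
proof (rule ccontr)
  assume "\<nexists>v. v \<notin> span S"
  then have all: "v \<in> span S" for v by blast
  let ?M = "lebesgue_on {0..1::real}"
  define I where "I i = {1 / (real i + 2)<..1 / (real i + 1)}" for i :: nat
  have I01: "I i \<subseteq> {0..1}" for i
  proof
    fix x assume "x \<in> I i"
    moreover have "0 < 1 / (real i + 2)" "1 / (real i + 1) \<le> 1" by auto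
    ultimately show "x \<in> {0..1}" unfolding I_def greaterThanAtMost_iff atLeastAtMost_iff by linarith
  qed
  have disj: "I i \<inter> I j = {}" if "i < j" for i j
  proof -
    have "1 / (real j + 1) \<le> 1 / (real i + 2)" using that by (intro divide_left_mono) auto
    then show ?thesis unfolding I_def by auto
  qed
  have L2: "L2fun (indicat_real (I i))" for i
  proof -
    have [measurable]: "I i \<in> sets ?M" using I01[of i] by (auto simp: I_def sets_restrict_space_iff)
    have "integrable ?M (\<lambda>\<xi>. (indicat_real (I i) \<xi>)\<^sup>2)"
      by (rule integrable_lebesgue_on_bounded[where C = 1]) (auto simp: indicator_def)
    then show ?thesis by (simp add: L2fun_def)
  qed
  then have "\<forall>i. \<exists>v. AE \<xi> in ?M. emb v \<xi> = indicat_real (I i) \<xi>"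
    using model by (simp add: L2_model_def)
  then obtain v where v: "\<And>i. AE \<xi> in ?M. emb (v i) \<xi> = indicat_real (I i) \<xi>" by metis
  have in_v: "inner (v i) (v j) = measure ?M (I i \<inter> I j)" for i j
  proof -
    have [measurable]: "emb w \<in> borel_measurable ?M" for w
      using model by (simp add: L2_model_def L2fun_def)
    have [measurable]: "I i \<in> sets ?M" for i using I01[of i] by (auto simp: I_def sets_restrict_space_iff)
    have "inner (v i) (v j) = (LINT \<xi>|?M. emb (v i) \<xi> * emb (v j) \<xi>)"
      using model by (simp add: L2_model_def)
    also have "\<dots> = (LINT \<xi>|?M. indicat_real (I i \<inter> I j) \<xi>)"
    proof (rule integral_cong_AE)
      show "AE \<xi> in ?M. emb (v i) \<xi> * emb (v j) \<xi> = indicat_real (I i \<inter> I j) \<xi>"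
        using v[of i] v[of j] by eventually_elim (simp add: indicator_inter_arith)
    qed measurable
    also have "\<dots> = measure ?M (I i \<inter> I j)" using I01[of i] by (simp add: Int_absorb2 inf.absorb1 le_infI1)
    finally show ?thesis .
  qed
  have orth: "inner (v i) (v j) = 0" if "i \<noteq> j" for i j
    using disj[of i j] disj[of j i] that in_v[of i j] by (cases "i < j") (auto simp: Int_commute)
  have pos: "v i \<noteq> 0" for i
  proof -
    have "measure ?M (I i) = measure lebesgue (I i)" using I01[of i] by (intro measure_restrict_space) auto
    also have "\<dots> = 1 / (real i + 1) - 1 / (real i + 2)"
      unfolding I_def by (simp add: divide_left_mono)
    also have "\<dots> > 0" by (simp add: divide_strict_left_mono)
    finally show ?thesis using in_v[of i i] by auto
  qed
  have inj: "inj v" using orth pos by (intro injI) (metis inner_eq_zero_iff)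
  \<comment> \<open>The index set \<open>{..card S}\<close> has \<open>card S + 1\<close> elements,
    one more than an independent set in the span of S can have.\<close>
  have ind: "independent (v ` {..card S})"
    using orth pos by (intro pairwise_orthogonal_independent) (auto simp: pairwise_def orthogonal_def intro: orth)
  have "card (v ` {..card S}) \<le> card S"
    by (rule conjunct2[OF independent_span_bound[OF S ind subsetI[OF all]]])
  then show False using card_image[OF inj_on_subset[OF inj], of "{..card S}"] by simp
qed

section \<open>Optimal feedback\<close>

text \<open>Riccati solutions are pinned down only on the horizon, so two forms of the feedback
  agree only there. This lemma and the next two let one form replace the other in the trajectory, in
  admissibility and in the cost.\<close>

lemma mild_cong:
  assumes "\<And>s. s \<in> {0..t} \<Longrightarrow> u s = v s"
  shows "mild AA BB x0 u t = mild AA BB x0 v t"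
  unfolding mild_def using assms by (intro arg_cong2[where f = "(+)"] refl Bochner_Integration.integral_cong) auto

lemma admissible_cong:
  assumes "\<And>s. s \<in> {0..T} \<Longrightarrow> u s = v s"
  shows "admissible T u \<longleftrightarrow> admissible T v"
  unfolding admissible_def
  by (intro arg_cong2[where f = "(\<and>)"] measurable_lebesgue_cong Bochner_Integration.integrable_cong)
    (use assms in auto)

lemma cost_cong:
  assumes uv: "\<And>s. s \<in> {0..T} \<Longrightarrow> u s = v s"
  shows "cost AA BB Q P0 T x0 u = cost AA BB Q P0 T x0 v"
proof -
  have "mild AA BB x0 u t = mild AA BB x0 v t" if "t \<le> T" for t
    using that uv by (intro mild_cong) auto
  then show ?thesis
    unfolding cost_def
    using uv by (intro arg_cong2[where f = "(+)"] Bochner_Integration.integral_cong) auto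
qed

lemma (in spectral_resolution) diag_nonneg:
  assumes K: "diag K k" and "nonneg_op K" and l: "l \<le> d" and v: "P l v = v" "v \<noteq> 0"
  shows "0 \<le> k l"
proof -
  have "0 \<le> inner v (blinfun_apply K v)" using assms by (simp add: nonneg_op_def)
  also have "\<dots> = inner v (P l (blinfun_apply K v))" using P_sym[OF l, of v] v(1) by simp
  also have "\<dots> = k l * inner v v" by (simp add: diag_P[OF K l] v(1))
  finally have "0 \<le> k l * inner v v" .
  moreover have "0 < inner v v" using v(2) by simp
  ultimately show ?thesis by (smt (verit) mult_neg_pos)
qed

text \<open>Index \<open>0\<close> is the projection onto the orthogonal complement, with eigenvalue \<open>0\<close>.\<close>
definition eigen_proj :: "nat \<Rightarrow> (nat \<Rightarrow> 'h::real_inner) \<Rightarrow> nat \<Rightarrow> 'h \<Rightarrow> 'h" where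
  "eigen_proj d f l v =
     (if l = 0 then v - (\<Sum>i=1..d. inner v (f i) *\<^sub>R f i) else inner v (f l) *\<^sub>R f l)"

lemma sum_atMost_split_0: "(\<Sum>l\<le>d. g l) = g 0 + (\<Sum>l=1..d. g l)" for g :: "nat \<Rightarrow> 'a::comm_monoid_add"
proof -
  have "{..d} = insert 0 {1..d}" by auto
  then show ?thesis by simp
qed

lemma spectral_resolution_eigen_proj:
  fixes f :: "nat \<Rightarrow> 'h::{real_inner,banach,second_countable_topology}"
  assumes orth: "\<forall>i\<in>{1..d}. \<forall>j\<in>{1..d}. inner (f i) (f j) = (if i = j then 1 else 0)"
  shows "spectral_resolution d (eigen_proj d f)"
proof (rule spectral_resolution.intro)
  let ?S = "\<lambda>v. \<Sum>i=1..d. inner v (f i) *\<^sub>R f i"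
  have inS: "inner (?S v) (f j) = inner v (f j)" if "j \<in> {1..d}" for v j
  proof -
    have "inner (?S v) (f j) = (\<Sum>i=1..d. if j = i then inner v (f i) else 0)"
      unfolding inner_sum_left using orth that by (intro sum.cong) auto
    then show ?thesis using that by simp
  qed
  show "bounded_linear (eigen_proj d f l)" if "l \<le> d" for l
    unfolding eigen_proj_def
    by (cases "l = 0")
      (auto intro!: bounded_linear_sub bounded_linear_ident bounded_linear_sum
        bounded_linear_compose[OF bounded_linear_scaleR_left bounded_linear_inner_left])
  show "eigen_proj d f i (eigen_proj d f j v) = (if i = j then eigen_proj d f j v else 0)"
    if "i \<le> d" "j \<le> d" for i j v
  proof -
    have i: "i \<noteq> 0 \<Longrightarrow> i \<in> {1..d}" and j: "j \<noteq> 0 \<Longrightarrow> j \<in> {1..d}" using that by auto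
    have SS: "(\<Sum>k=1..d. inner (v - ?S v) (f k) *\<^sub>R f k) = 0"
      by (intro sum.neutral ballI) (simp add: inner_diff_left inS del: One_nat_def)
    have Sc: "(\<Sum>k=1..d. (c * (if j = k then 1 else 0)) *\<^sub>R f k) = c *\<^sub>R f j" if "j \<noteq> 0" "j \<le> d" for c j
    proof -
      have "(\<Sum>k=1..d. (c * (if j = k then 1 else 0)) *\<^sub>R f k) = (\<Sum>k=1..d. if j = k then c *\<^sub>R f k else 0)"
        by (intro sum.cong) auto
      then show ?thesis using that by simp
    qed
    show ?thesis
      using i j orth inS SS by (auto simp: eigen_proj_def inner_diff_left Sc simp del: One_nat_def)
  qed
  show "inner (eigen_proj d f l v) w = inner v (eigen_proj d f l w)" for l v w
    by (simp add: eigen_proj_def inner_diff_left inner_diff_right inner_sum_left inner_sum_right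
        inner_commute mult.commute)
  show "(\<Sum>l\<le>d. eigen_proj d f l v) = v" for v
    unfolding sum_atMost_split_0 by (simp add: eigen_proj_def)
qed

text \<open>With the convention 0^0 = 1 the eigenvalue 0 of the complement selects the constant
  coefficients; hence \<open>beta 0\<close>, \<open>q 0\<close> and \<open>z 0\<close> in the
  equation for L.\<close>

lemma rpoly_0: "rpoly c n 0 = c 0"
  by (simp add: rpoly_def power_0_left if_distrib cong: if_cong)

text \<open>Optimality is claimed for all Riccati solutions and all continuous closed-loop
  trajectories. The separate existence claims keep these quantifiers from being vacuous.\<close>

theorem theorem1:
  fixes emb :: "'h::{real_inner,banach,second_countable_topology} \<Rightarrow> (real \<Rightarrow> real)"
    and Aker :: "real \<Rightarrow> real \<Rightarrow> real"
    and Aop :: "'h \<Rightarrow>\<^sub>L 'h"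
    and d :: nat and lam :: "nat \<Rightarrow> real" and f :: "nat \<Rightarrow> 'h"
    and alpha0 :: real and beta :: "nat \<Rightarrow> real" and bL :: nat
    and q :: "nat \<Rightarrow> real" and h :: nat and z :: "nat \<Rightarrow> real" and r :: nat
    and T :: real and x0 :: 'h
  defines "AA \<equiv> alpha0 *\<^sub>R id_blinfun + Aop"
    and "BB \<equiv> oppoly beta bL Aop"
    and "Q \<equiv> oppoly q h Aop"
    and "P0 \<equiv> oppoly z r Aop"
  assumes model: "L2_model emb"
    and ker_meas: "(\<lambda>p. Aker (fst p) (snd p)) \<in> borel_measurable (lebesgue_on ({0..1} \<times> {0..1}))"
    and ker_sym: "\<forall>x\<in>{0..1}. \<forall>y\<in>{0..1}. Aker x y = Aker y x"
    and ker_bound: "\<forall>x\<in>{0..1}. \<forall>y\<in>{0..1}. \<bar>Aker x y\<bar> \<le> 1"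
    and ker_op: "is_integral_operator emb Aker Aop"
    and lam_nz: "\<forall>l\<in>{1..d}. lam l \<noteq> 0"
    and f_orth: "\<forall>i\<in>{1..d}. \<forall>j\<in>{1..d}. inner (f i) (f j) = (if i = j then 1 else 0)"
    and ker_rep: "AE p in lebesgue_on ({0..1} \<times> {0..1}).
         Aker (fst p) (snd p) = (\<Sum>l=1..d. lam l * emb (f l) (fst p) * emb (f l) (snd p))"
    and Q_sa: "self_adjoint_op Q" and Q_nn: "nonneg_op Q"
    and P0_sa: "self_adjoint_op P0" and P0_nn: "nonneg_op P0"
    and T_pos: "0 < T"
  shows "(\<exists>L :: real \<Rightarrow> ('h \<Rightarrow>\<^sub>L 'h). riccati_sol T alpha0 (beta 0) (q 0) (z 0) L)
   \<and> (\<forall>l\<in>{1..d}. \<exists>M :: real \<Rightarrow> ('h \<Rightarrow>\<^sub>L 'h). riccati_sol T (alpha0 + lam l) (rpoly beta bL (lam l))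
                          (rpoly q h (lam l)) (rpoly z r (lam l)) M)
   \<and> (\<forall>L M. riccati_sol T alpha0 (beta 0) (q 0) (z 0) L
        \<longrightarrow> (\<forall>l\<in>{1..d}. riccati_sol T (alpha0 + lam l) (rpoly beta bL (lam l))
                          (rpoly q h (lam l)) (rpoly z r (lam l)) (M l))
        \<longrightarrow> (let fb = (\<lambda>t y.
                 - ((beta 0) *\<^sub>R blinfun_apply (L (T - t)) (y - (\<Sum>l=1..d. inner y (f l) *\<^sub>R f l)))
                 - (\<Sum>l=1..d. rpoly beta bL (lam l) *\<^sub>R
                       blinfun_apply (M l (T - t)) (inner y (f l) *\<^sub>R f l)))
             in (\<exists>x. continuous_on {0..T} x
                     \<and> (\<forall>t\<in>{0..T}. x t = mild AA BB x0 (\<lambda>s. fb s (x s)) t))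
              \<and> (\<forall>x. continuous_on {0..T} x
                     \<and> (\<forall>t\<in>{0..T}. x t = mild AA BB x0 (\<lambda>s. fb s (x s)) t)
                   \<longrightarrow> admissible T (\<lambda>s. fb s (x s))
                     \<and> (\<forall>v. admissible T v
                          \<longrightarrow> cost AA BB Q P0 T x0 (\<lambda>s. fb s (x s)) \<le> cost AA BB Q P0 T x0 v))))"
proof -
  define P where "P = eigen_proj d f"
  \<comment> \<open>\<open>lam 0\<close> is unconstrained, so the eigenvalue at index 0 is set
    explicitly.\<close>
  define \<mu> where "\<mu> l = (if l = 0 then 0 else lam l)" for l
  define a where "a l = alpha0 + \<mu> l" for l
  define b where "b l = rpoly beta bL (\<mu> l)" for l
  define qc where "qc l = rpoly q h (\<mu> l)" for l
  define zc where "zc l = rpoly z r (\<mu> l)" for l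
  interpret spectral_resolution d P
    unfolding P_def by (rule spectral_resolution_eigen_proj[OF f_orth])
  have dA: "diag Aop \<mu>"
    unfolding diag_def
  proof
    fix v
    have "blinfun_apply Aop v = (\<Sum>l=1..d. lam l *\<^sub>R (inner v (f l) *\<^sub>R f l))"
      by (rule integral_operator_finite_rank[OF model ker_op ker_rep])
    then show "blinfun_apply Aop v = (\<Sum>l\<le>d. \<mu> l *\<^sub>R P l v)"
      unfolding sum_atMost_split_0 by (simp add: \<mu>_def P_def eigen_proj_def)
  qed
  have dAA: "diag AA a"
    using diag_add[OF diag_scaleR[OF diag_id, of alpha0] dA] by (simp add: AA_def a_def[abs_def])
  have dBB: "diag BB b" using diag_oppoly[OF dA] by (simp add: BB_def b_def[abs_def])
  have dQ: "diag Q qc" using diag_oppoly[OF dA] by (simp add: Q_def qc_def[abs_def])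
  have dP0: "diag P0 zc" using diag_oppoly[OF dA] by (simp add: P0_def zc_def[abs_def])
  have ex: "\<exists>v. P l v = v \<and> v \<noteq> 0" if l: "l \<le> d" for l
  proof (cases "l = 0")
    case True
    obtain w where w: "w \<notin> span (f ` {1..d})"
      using L2_model_infinite_dimensional[OF model, of "f ` {1..d}"] by auto
    have "P 0 w \<noteq> 0"
    proof
      assume "P 0 w = 0"
      then have "w = (\<Sum>i=1..d. inner w (f i) *\<^sub>R f i)" by (simp add: P_def eigen_proj_def)
      also have "\<dots> \<in> span (f ` {1..d})" by (intro span_sum span_scale span_base) auto
      finally show False using w by simp
    qed
    moreover have "P 0 (P 0 w) = P 0 w" by (simp add: P_P)
    ultimately show ?thesis using True by blast
  next
    case False
    then have "inner (f l) (f l) = 1" using f_orth l by simp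
    then have "P l (f l) = f l" "f l \<noteq> 0" using False by (auto simp: P_def eigen_proj_def)
    then show ?thesis by blast
  qed
  have q_nonneg: "0 \<le> qc l" and z_nonneg: "0 \<le> zc l" if "l \<le> d" for l
    using ex[OF that] diag_nonneg[OF dQ Q_nn that] diag_nonneg[OF dP0 P0_nn that] by blast+
  \<comment> \<open>Packing X and m into one pair leaves a single existential per mode, so one
    choice over l yields both families.\<close>
  have "\<exists>Xm. snd Xm 0 = zc l \<and> (\<forall>t\<ge>0. 0 < fst Xm t
      \<and> (fst Xm has_real_derivative ((b l)\<^sup>2 * snd Xm t - a l) * fst Xm t) (at t)
      \<and> (snd Xm has_real_derivative 2 * a l * snd Xm t - (b l)\<^sup>2 * (snd Xm t)\<^sup>2 + qc l) (at t))"
    if "l \<le> d" for l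
  proof (rule scalar_riccati_exists[OF q_nonneg[OF that] z_nonneg[OF that], of "b l" "a l"], goal_cases)
    case (1 X m)
    then show ?case by (intro exI[of _ "(X, m)"]) simp
  qed
  then obtain Xm where Xm: "\<And>l. l \<le> d \<Longrightarrow> snd (Xm l) 0 = zc l \<and> (\<forall>t\<ge>0. 0 < fst (Xm l) t
      \<and> (fst (Xm l) has_real_derivative ((b l)\<^sup>2 * snd (Xm l) t - a l) * fst (Xm l) t) (at t)
      \<and> (snd (Xm l) has_real_derivative 2 * a l * snd (Xm l) t - (b l)\<^sup>2 * (snd (Xm l) t)\<^sup>2 + qc l) (at t))"
    by metis
  define X where "X l = fst (Xm l)" for l
  define m where "m l = snd (Xm l)" for l
  have m0: "m l 0 = zc l" and X_pos: "0 \<le> t \<Longrightarrow> 0 < X l t"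
    and X_der: "0 \<le> t \<Longrightarrow> (X l has_real_derivative ((b l)\<^sup>2 * m l t - a l) * X l t) (at t)"
    and m_der: "0 \<le> t \<Longrightarrow> (m l has_real_derivative 2 * a l * m l t - (b l)\<^sup>2 * (m l t)\<^sup>2 + qc l) (at t)"
    if "l \<le> d" for l t
    using Xm[OF that] by (auto simp: X_def m_def)
  \<comment> \<open>Time reversal turns the initial value problem for m into the terminal value
    problem that the costate identity requires.\<close>
  define p where "p l t = m l (T - t)" for l t
  have pT: "p l T = zc l" if "l \<le> d" for l using m0[OF that] by (simp add: p_def)
  have reflect: "((\<lambda>t. g (T - t)) has_real_derivative - g') (at t within {0..T})"
    if "(g has_real_derivative g') (at (T - t))" for g g' t
  proof -
    have "((\<lambda>t. T - t) has_real_derivative -1) (at t within {0..T})"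
      by (auto intro!: derivative_eq_intros)
    from DERIV_chain2[OF that this] show ?thesis by simp
  qed
  have p_der: "(p l has_real_derivative - (2 * a l * p l t) + (b l)\<^sup>2 * (p l t)\<^sup>2 - qc l) (at t within {0..T})"
    if "l \<le> d" "t \<in> {0..T}" for l t
    using reflect[OF m_der[OF that(1), of "T - t"]] that(2) unfolding p_def[abs_def] by simp
  \<comment> \<open>Reversing time also flips the sign of the growth rate of X to
    \<open>a l - (b l)^2 * p l t\<close>; division by \<open>X l T\<close> normalises the value at
    time 0 to 1.\<close>
  define \<rho> where "\<rho> l t = X l (T - t) / X l T" for l t
  have \<rho>0: "\<rho> l 0 = 1" if "l \<le> d" for l
    using X_pos[OF that, of T] T_pos by (simp add: \<rho>_def)
  have \<rho>_der: "(\<rho> l has_real_derivative (a l - (b l)\<^sup>2 * p l t) * \<rho> l t) (at t within {0..T})"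
    if "l \<le> d" "t \<in> {0..T}" for l t
    using DERIV_cdivide[OF reflect[OF X_der[OF that(1), of "T - t"]], of "X l T"] that(2)
    unfolding \<rho>_def[abs_def] p_def by (simp add: algebra_simps diff_divide_distrib)
  have riccati_mode: "riccati_sol T (a l) (b l) (qc l) (zc l) (\<lambda>t. m l t *\<^sub>R (id_blinfun :: 'h \<Rightarrow>\<^sub>L 'h))"
    if "l \<le> d" for l
    by (rule riccati_sol_scalar[where m = "m l", OF m0[OF that] m_der[OF that]]) simp
  have coeff_0: "a 0 = alpha0" "b 0 = beta 0" "qc 0 = q 0" "zc 0 = z 0"
    by (simp_all add: a_def b_def qc_def zc_def \<mu>_def rpoly_0)
  have coeff: "a l = alpha0 + lam l" "b l = rpoly beta bL (lam l)" "qc l = rpoly q h (lam l)"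
    "zc l = rpoly z r (lam l)" if "l \<in> {1..d}" for l
    using that by (simp_all add: a_def b_def qc_def zc_def \<mu>_def)
  have optimal: "let fb = (\<lambda>t y.
                 - ((beta 0) *\<^sub>R blinfun_apply (L (T - t)) (y - (\<Sum>l=1..d. inner y (f l) *\<^sub>R f l)))
                 - (\<Sum>l=1..d. rpoly beta bL (lam l) *\<^sub>R
                       blinfun_apply (M l (T - t)) (inner y (f l) *\<^sub>R f l)))
             in (\<exists>x. continuous_on {0..T} x
                     \<and> (\<forall>t\<in>{0..T}. x t = mild AA BB x0 (\<lambda>s. fb s (x s)) t))
              \<and> (\<forall>x. continuous_on {0..T} x
                     \<and> (\<forall>t\<in>{0..T}. x t = mild AA BB x0 (\<lambda>s. fb s (x s)) t)
                   \<longrightarrow> admissible T (\<lambda>s. fb s (x s))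
                     \<and> (\<forall>v. admissible T v
                          \<longrightarrow> cost AA BB Q P0 T x0 (\<lambda>s. fb s (x s)) \<le> cost AA BB Q P0 T x0 v))"
    if L: "riccati_sol T alpha0 (beta 0) (q 0) (z 0) L"
      and M: "\<forall>l\<in>{1..d}. riccati_sol T (alpha0 + lam l) (rpoly beta bL (lam l))
                          (rpoly q h (lam l)) (rpoly z r (lam l)) (M l)" for L M
  proof -
    define fb where "fb = (\<lambda>t y.
                 - ((beta 0) *\<^sub>R blinfun_apply (L (T - t)) (y - (\<Sum>l=1..d. inner y (f l) *\<^sub>R f l)))
                 - (\<Sum>l=1..d. rpoly beta bL (lam l) *\<^sub>R
                       blinfun_apply (M l (T - t)) (inner y (f l) *\<^sub>R f l)))"
    \<comment> \<open>The diagonal form of the feedback, written with the scalar solutions. Outside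
      the horizon it may differ from \<open>fb\<close>, whose operators are unconstrained
      there.\<close>
    define fb' where "fb' s y = (\<Sum>l\<le>d. (- (b l * p l s)) *\<^sub>R P l y)" for s y
    have fb_eq: "fb s y = fb' s y" if s: "s \<in> {0..T}" for s y
    proof -
      have Ts: "T - s \<in> {0..T}" using s by auto
      \<comment> \<open>The arbitrary operator solutions become scalar here: each coincides with the
        constructed solution of its mode times the identity.\<close>
      have K: "K (T - s) = p l s *\<^sub>R id_blinfun"
        if "riccati_sol T (a l) (b l) (qc l) (zc l) K" "l \<le> d" for K :: "real \<Rightarrow> ('h \<Rightarrow>\<^sub>L 'h)" and l
        unfolding p_def by (rule riccati_sol_unique[OF that(1) m0[OF that(2)] m_der[OF that(2)] Ts]) simp
      have "L (T - s) = p 0 s *\<^sub>R id_blinfun" using L by (intro K) (simp_all add: coeff_0)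
      moreover have "M l (T - s) = p l s *\<^sub>R id_blinfun" if l: "l \<in> {1..d}" for l
        using M l by (intro K) (simp_all add: coeff[OF l])
      ultimately show ?thesis
        unfolding fb_def fb'_def sum_atMost_split_0
        by (simp add: P_def eigen_proj_def blinfun.scaleR_left coeff coeff_0 sum_negf mult.assoc)
    qed
    have mild_eq: "mild AA BB x0 (\<lambda>s. fb s (x s)) t = mild AA BB x0 (\<lambda>s. fb' s (x s)) t"
      if "t \<in> {0..T}" for x t
      using that by (intro mild_cong fb_eq) auto
    have "\<exists>x. continuous_on {0..T} x \<and> (\<forall>t\<in>{0..T}. x t = mild AA BB x0 (\<lambda>s. fb s (x s)) t)"
    proof -
      have pc: "continuous_on {0..T} (p l)" if "l \<le> d" for l
        by (rule DERIV_continuous_on[OF p_der[OF that]])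
      obtain x where x: "continuous_on {0..T} x"
          "\<And>t. t \<in> {0..T} \<Longrightarrow> x t = mild AA BB x0 (\<lambda>s. fb' s (x s)) t"
        by (rule closed_loop_exists[where ?x0.0 = x0, OF dAA dBB pc \<rho>0 \<rho>_der, folded fb'_def]) (assumption | rule that)+
      have "x t = mild AA BB x0 (\<lambda>s. fb s (x s)) t" if "t \<in> {0..T}" for t
        unfolding mild_eq[OF that] by (rule x(2)[OF that])
      with x(1) show ?thesis by blast
    qed
    moreover have "admissible T (\<lambda>s. fb s (x s)) \<and> (\<forall>v. admissible T v
        \<longrightarrow> cost AA BB Q P0 T x0 (\<lambda>s. fb s (x s)) \<le> cost AA BB Q P0 T x0 v)"
      if x: "continuous_on {0..T} x" "\<forall>t\<in>{0..T}. x t = mild AA BB x0 (\<lambda>s. fb s (x s)) t" for x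
    proof -
      have x': "x t = mild AA BB x0 (\<lambda>s. fb' s (x s)) t" if "t \<in> {0..T}" for t
        unfolding mild_eq[OF that, symmetric] using x(2) that by blast
      have adm: "admissible T (\<lambda>s. fb s (x s)) \<longleftrightarrow> admissible T (\<lambda>s. fb' s (x s))"
        by (rule admissible_cong) (rule fb_eq)
      have cost: "cost AA BB Q P0 T x0 (\<lambda>s. fb s (x s)) = cost AA BB Q P0 T x0 (\<lambda>s. fb' s (x s))"
        by (rule cost_cong) (rule fb_eq)
      note opt = feedback_optimal[OF dAA dBB dQ dP0 less_imp_le[OF T_pos] q_nonneg z_nonneg pT p_der x(1) x' fb'_def]
      show ?thesis unfolding adm cost
      proof (intro conjI allI impI)
        show "admissible T (\<lambda>s. fb' s (x s))" by (rule opt(1))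
        show "cost AA BB Q P0 T x0 (\<lambda>s. fb' s (x s)) \<le> cost AA BB Q P0 T x0 v" if "admissible T v" for v
          by (rule opt(2)[OF _ _ _ _ _ _ that])
      qed
    qed
    ultimately show ?thesis unfolding Let_def fb_def[symmetric] by blast
  qed
  have "\<exists>L :: real \<Rightarrow> ('h \<Rightarrow>\<^sub>L 'h). riccati_sol T alpha0 (beta 0) (q 0) (z 0) L"
    using riccati_mode[of 0] unfolding coeff_0 by blast
  moreover have "\<forall>l\<in>{1..d}. \<exists>M :: real \<Rightarrow> ('h \<Rightarrow>\<^sub>L 'h). riccati_sol T (alpha0 + lam l) (rpoly beta bL (lam l))
                          (rpoly q h (lam l)) (rpoly z r (lam l)) M"
  proof
    fix l assume l: "l \<in> {1..d}"
    then have "l \<le> d" by simp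
    from riccati_mode[OF this] show "\<exists>M :: real \<Rightarrow> ('h \<Rightarrow>\<^sub>L 'h). riccati_sol T (alpha0 + lam l)
        (rpoly beta bL (lam l)) (rpoly q h (lam l)) (rpoly z r (lam l)) M"
      unfolding coeff[OF l] by blast
  qed
  ultimately show ?thesis using optimal by blast
qed

end
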